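(* Let $\Phi$ be a non-autonomous finite conformal iterated function system satisfying the open set condition, and let $E\subset\mathbb R^d$ be its non-autonomous finite conformal set. Suppose that $$\lim_{k\to+\infty}\frac{\log \overline c_k-\log \#I_k}{\log M_k}=0 .$$ Then $$\overline{\dim}_{\rm B}E\ge\dim_{\rm P}E\ge s^* .$$
   Context: $\overline{\dim}_{\rm B}$ and $\dim_{\rm P}$ are upper box and packing dimension. Words. $\{I_k\}_{k\ge 1}$ is a sequence of index sets with $2\le \#I_k<\infty$. For $k\ge l\ge 1$, $\Sigma_l^k=\{u_l\cdots u_k: u_j\in I_j\}$; $\Sigma^k=\Sigma_1^k$, $\Sigma^0=\{\emptyset\}$, $\Sigma^*=\bigcup_{k\ge 0}\Sigma^k$. System. $J\subset\mathbb R^d$ is compact with non-empty interior and $\overline{\mathrm{int}(J)}=J$. For each $k\ge1$, $\Phi_k=\{\varphi_{k,i}\}_{i\in I_k}$ is a family of maps $\varphi_{k,i}:J\to J$. For $\mathbf u=u_l\cdots u_k\in\Sigma_l^k$, $\varphi_{\mathbf u}=\varphi_{l,u_l}\circ\cdots\circ\varphi_{k,u_k}$ (and $\varphi_\emptyset=\mathrm{id}$). $\Phi=\{\Phi_k\}_{k\ge1}$, together with a family $\{J_{\mathbf u}:\mathbf u\in\Sigma^*\}$ of closed subsets of $J$, is a non-autonomous finite iterated function system if: (i) there is $0<c<1$ with $|\varphi_{k,i}(x)-\varphi_{k,i}(y)|\le c|x-y|$ for all $k$, $i\in I_k$, $x,y\in J$; (ii) $J_\emptyset=J$ and $J_{\mathbf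 u i}\subset J_{\mathbf u}$ for all $\mathbf u\in\Sigma^{k-1}$, $i\in I_k$, $k\ge1$; (iii) for each $\mathbf u\in\Sigma^*$ there is $\omega_{\mathbf u}\in\mathbb R^d$ such that $J_{\mathbf u}=\Psi_{\mathbf u}(J)$ with $\Psi_{\mathbf u}=\varphi_{\mathbf u}+\omega_{\mathbf u}$. Its attractor is $E=\bigcap_{k\ge1}\bigcup_{\mathbf u\in\Sigma^k}J_{\mathbf u}$. The open set condition (OSC) means: for all $k\ge0$, $\mathbf u\in\Sigma^k$ and $i\ne j\in I_{k+1}$, $\mathrm{int}(J_{\mathbf ui})\cap\mathrm{int}(J_{\mathbf uj})=\emptyset$. Conformality. $\Phi$ is conformal (and $E$ is called a non-autonomous finite conformal set) if there is an open connected set $V\supset J$, independent of $k$, such that each $\varphi_{k,j}$ extends to a $C^1$ conformal diffeomorphism of $V$ into $V$ (the derivative at each point is a similarity linear map), and there is $C\ge1$ with $\|D\varphi_{\mathbf u}(x)\|\le C\|D\varphi_{\mathbf u}(y)\|$ for all $x,y\in V$ and all $\mathbf u\in\Sigma_l^k$, $k\ge l\ge1$. Here $\|D\varphi(x)\|$ is the scaling factor of $D\varphi(x)$ and $\|D\varphi\|=\sup_{x\in J}\|D\varphi(x)\|$. Put $M_k=\sup_{\mathbf u\in\Sigma^k}\|D\varphi_{\mathbf u}\|$ and $\overline c_k=\sup_{j\in I_k}\|D\varphi_{k,j}\|$. Upper pressure: $\overline P(t)=\limsup_{k\to\infty}\frac1k\log\sum_{\mathbf u\in\Sigma^k}\|D\varphi_{\mathbf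 u}\|^t$, and $s^*=\inf\{t:\overline P(t)<0\}=\sup\{t:\overline P(t)>0\}$. *)

theory Defs
  imports "HOL-Analysis.Analysis"
begin

section \<open>Upper box dimension and packing dimension\<close>

text \<open>The explicit \<^const>\<open>bounded\<close> is needed since \<^const>\<open>diameter\<close> is only meaningful for bounded
  sets. The number is meaningful for bounded sets \<open>F\<close> only.\<close>

definition covering_number :: "real \<Rightarrow> 'a::euclidean_space set \<Rightarrow> nat" where
  "covering_number r F =
     (LEAST n. \<exists>\<U>. finite \<U> \<and> card \<U> = n \<and> F \<subseteq> \<Union>\<U> \<and> (\<forall>U\<in>\<U>. bounded U \<and> diameter U \<le> r))"

definition upper_box_dim :: "'a::euclidean_space set \<Rightarrow> ereal" where
  "upper_box_dim F =
     Limsup (at_right 0) (\<lambda>r. ereal (ln (real (covering_number r F)) / (- ln r)))"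

text \<open>A \<open>\<delta>\<close>-packing of \<open>F\<close> is encoded as a set of (centre, radius) pairs of pairwise disjoint
  closed balls. The ball of radius \<open>r\<close> contributes its diameter \<open>2 * r\<close> to the power \<open>s\<close>.\<close>

definition packings :: "real \<Rightarrow> 'a::euclidean_space set \<Rightarrow> ('a \<times> real) set set" where
  "packings \<delta> F =
     {B. countable B \<and> (\<forall>(x, r)\<in>B. x \<in> F \<and> 0 < r \<and> r \<le> \<delta>) \<and>
         disjoint_family_on (\<lambda>(x, r). cball x r) B}"

definition packing_premeasure_at :: "real \<Rightarrow> real \<Rightarrow> 'a::euclidean_space set \<Rightarrow> ennreal" where
  "packing_premeasure_at s \<delta> F =
     (SUP B\<in>packings \<delta> F. \<Sum>\<^sub>\<infinity>(x, r)\<in>B. ennreal ((2 * r) powr s))"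

text \<open>The previous quantity decreases with \<open>\<delta>\<close>, so its limit as \<open>\<delta>\<close> tends to 0 is the infimum.\<close>

definition packing_premeasure :: "real \<Rightarrow> 'a::euclidean_space set \<Rightarrow> ennreal" where
  "packing_premeasure s F = (INF \<delta>\<in>{0<..}. packing_premeasure_at s \<delta> F)"

definition packing_measure :: "real \<Rightarrow> 'a::euclidean_space set \<Rightarrow> ennreal" where
  "packing_measure s F =
     (INF A\<in>{A :: nat \<Rightarrow> 'a set. F \<subseteq> (\<Union>i. A i)}. \<Sum>i. packing_premeasure s (A i))"

definition packing_dim :: "'a::euclidean_space set \<Rightarrow> ereal" where
  "packing_dim F = Inf {ereal s |s. 0 \<le> s \<and> packing_measure s F = 0}"


section \<open>Non-autonomous iterated function systems\<close>

text \<open>The word \<open>u\<^sub>l \<dots> u\<^sub>k\<close> is the list \<open>[u\<^sub>l, \<dots>, u\<^sub>k]\<close>; in particular \<open>words I 1 0\<close> contains just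
  the empty word, and \<open>words I 1 k\<close> is the set of words of length \<open>k\<close> starting at level 1.
  The index sets are \<open>I k\<close> for \<open>k \<ge> 1\<close>; the value \<open>I 0\<close> is irrelevant, as are the maps
  \<open>\<phi> 0\<close> below.\<close>

definition words :: "(nat \<Rightarrow> 'i set) \<Rightarrow> nat \<Rightarrow> nat \<Rightarrow> 'i list set" where
  "words I l k = {u. length u = k + 1 - l \<and> (\<forall>j<length u. u ! j \<in> I (l + j))}"

text \<open>\<open>word_map \<phi> l u\<close> is the composition \<open>\<phi>\<^sub>u\<close> for a word \<open>u\<close> whose first letter is at level \<open>l\<close>.\<close>

primrec word_map :: "(nat \<Rightarrow> 'i \<Rightarrow> 'a \<Rightarrow> 'a) \<Rightarrow> nat \<Rightarrow> 'i list \<Rightarrow> 'a \<Rightarrow> 'a" where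
  "word_map \<phi> l [] = id"
| "word_map \<phi> l (i # u) = \<phi> l i \<circ> word_map \<phi> (Suc l) u"

definition nonautonomous_ifs ::
  "(nat \<Rightarrow> 'i set) \<Rightarrow> 'a::euclidean_space set \<Rightarrow> (nat \<Rightarrow> 'i \<Rightarrow> 'a \<Rightarrow> 'a) \<Rightarrow> ('i list \<Rightarrow> 'a set) \<Rightarrow> bool"
where
  "nonautonomous_ifs I J \<phi> Jw \<longleftrightarrow>
     (\<forall>k\<ge>1. finite (I k) \<and> 2 \<le> card (I k)) \<and>
     compact J \<and> interior J \<noteq> {} \<and> closure (interior J) = J \<and>
     (\<forall>k\<ge>1. \<forall>i\<in>I k. \<phi> k i ` J \<subseteq> J) \<and>
     (\<forall>k. \<forall>u\<in>words I 1 k. closed (Jw u) \<and> Jw u \<subseteq> J) \<and>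
     (\<exists>c. 0 < c \<and> c < 1 \<and>
        (\<forall>k\<ge>1. \<forall>i\<in>I k. \<forall>x\<in>J. \<forall>y\<in>J. norm (\<phi> k i x - \<phi> k i y) \<le> c * norm (x - y))) \<and>
     Jw [] = J \<and>
     (\<forall>k\<ge>1. \<forall>u\<in>words I 1 (k - 1). \<forall>i\<in>I k. Jw (u @ [i]) \<subseteq> Jw u) \<and>
     (\<forall>k. \<forall>u\<in>words I 1 k. \<exists>\<omega>. Jw u = (\<lambda>x. word_map \<phi> 1 u x + \<omega>) ` J)"

definition attractor :: "(nat \<Rightarrow> 'i set) \<Rightarrow> ('i list \<Rightarrow> 'a set) \<Rightarrow> 'a set" where
  "attractor I Jw = (\<Inter>k\<in>{1..}. \<Union>u\<in>words I 1 k. Jw u)"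

definition open_set_condition ::
  "(nat \<Rightarrow> 'i set) \<Rightarrow> ('i list \<Rightarrow> 'a::euclidean_space set) \<Rightarrow> bool" where
  "open_set_condition I Jw \<longleftrightarrow>
     (\<forall>k. \<forall>u\<in>words I 1 k. \<forall>i\<in>I (k + 1). \<forall>j\<in>I (k + 1). i \<noteq> j \<longrightarrow>
        interior (Jw (u @ [i])) \<inter> interior (Jw (u @ [j])) = {})"


section \<open>Conformality\<close>

definition similarity_linear :: "('a::euclidean_space \<Rightarrow> 'a) \<Rightarrow> bool" where
  "similarity_linear L \<longleftrightarrow> linear L \<and> (\<exists>\<rho>>0. \<forall>v. norm (L v) = \<rho> * norm v)"

definition scaling_factor :: "('a::euclidean_space \<Rightarrow> 'a) \<Rightarrow> real" where
  "scaling_factor L = (THE \<rho>. \<forall>v. norm (L v) = \<rho> * norm v)"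

definition deriv_scale :: "('a::euclidean_space \<Rightarrow> 'a) \<Rightarrow> 'a \<Rightarrow> real" where
  "deriv_scale f x = scaling_factor (frechet_derivative f (at x))"

definition C1_on :: "'a::euclidean_space set \<Rightarrow> ('a \<Rightarrow> 'a) \<Rightarrow> bool" where
  "C1_on S f \<longleftrightarrow>
     (\<exists>f' :: 'a \<Rightarrow> 'a \<Rightarrow>\<^sub>L 'a. continuous_on S f' \<and>
        (\<forall>x\<in>S. (f has_derivative blinfun_apply (f' x)) (at x)))"

definition conformal_diffeo_into :: "'a::euclidean_space set \<Rightarrow> ('a \<Rightarrow> 'a) \<Rightarrow> bool" where
  "conformal_diffeo_into V f \<longleftrightarrow>
     f ` V \<subseteq> V \<and> inj_on f V \<and> C1_on V f \<and> open (f ` V) \<and> C1_on (f ` V) (inv_into V f) \<and>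
     (\<forall>x\<in>V. similarity_linear (frechet_derivative f (at x)))"

text \<open>The maps \<open>\<phi> k i\<close> are total functions on the ambient space. In
  \<^const>\<open>nonautonomous_ifs\<close>, \<^const>\<open>open_set_condition\<close> and \<^const>\<open>attractor\<close> only their values on
  \<open>J\<close> matter; in the conformal case, their values on \<open>V - J\<close> are those of the chosen conformal
  extension, so that the same symbol \<open>\<phi>\<close> denotes the system and its extension to \<open>V\<close>. The derivatives
  on \<open>J\<close> depend neither on \<open>V\<close> nor on the extension, because \<open>J\<close> is the closure of its interior and
  the extensions are continuously differentiable.\<close>

definition conformal_system ::
  "(nat \<Rightarrow> 'i set) \<Rightarrow> 'a::euclidean_space set \<Rightarrow> (nat \<Rightarrow> 'i \<Rightarrow> 'a \<Rightarrow> 'a) \<Rightarrow> bool" where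
  "conformal_system I J \<phi> \<longleftrightarrow>
     (\<exists>V. open V \<and> connected V \<and> J \<subseteq> V \<and>
        (\<forall>k\<ge>1. \<forall>i\<in>I k. conformal_diffeo_into V (\<phi> k i)) \<and>
        (\<exists>C\<ge>1. \<forall>l\<ge>1. \<forall>k\<ge>l. \<forall>u\<in>words I l k. \<forall>x\<in>V. \<forall>y\<in>V.
           deriv_scale (word_map \<phi> l u) x \<le> C * deriv_scale (word_map \<phi> l u) y))"

definition deriv_norm :: "'a::euclidean_space set \<Rightarrow> ('a \<Rightarrow> 'a) \<Rightarrow> real" where
  "deriv_norm J f = (SUP x\<in>J. deriv_scale f x)"

definition max_word_norm ::
  "(nat \<Rightarrow> 'i set) \<Rightarrow> 'a::euclidean_space set \<Rightarrow> (nat \<Rightarrow> 'i \<Rightarrow> 'a \<Rightarrow> 'a) \<Rightarrow> nat \<Rightarrow> real" where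
  "max_word_norm I J \<phi> k = (SUP u\<in>words I 1 k. deriv_norm J (word_map \<phi> 1 u))"

definition max_level_norm ::
  "(nat \<Rightarrow> 'i set) \<Rightarrow> 'a::euclidean_space set \<Rightarrow> (nat \<Rightarrow> 'i \<Rightarrow> 'a \<Rightarrow> 'a) \<Rightarrow> nat \<Rightarrow> real" where
  "max_level_norm I J \<phi> k = (SUP j\<in>I k. deriv_norm J (\<phi> k j))"

definition upper_pressure ::
  "(nat \<Rightarrow> 'i set) \<Rightarrow> 'a::euclidean_space set \<Rightarrow> (nat \<Rightarrow> 'i \<Rightarrow> 'a \<Rightarrow> 'a) \<Rightarrow> real \<Rightarrow> ereal" where
  "upper_pressure I J \<phi> t =
     limsup (\<lambda>k. ereal (1 / real k * ln (\<Sum>u\<in>words I 1 k. deriv_norm J (word_map \<phi> 1 u) powr t)))"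

text \<open>This is the number \<open>s\<^sup>*\<close>. For the systems considered here it is also
  the supremum of all \<open>t\<close> with positive upper pressure: the pressure at 0 is positive, and the uniform
  contraction makes the pressure strictly decreasing wherever it is finite.\<close>

definition critical_exponent ::
  "(nat \<Rightarrow> 'i set) \<Rightarrow> 'a::euclidean_space set \<Rightarrow> (nat \<Rightarrow> 'i \<Rightarrow> 'a \<Rightarrow> 'a) \<Rightarrow> ereal" where
  "critical_exponent I J \<phi> = Inf {ereal t |t. upper_pressure I J \<phi> t < 0}"

end

theory Submission
  imports Defs
begin

text \<open>The inequality between the two dimensions holds for every non-empty bounded set: the balls of
  similar radius in a packing have separated centres, so their number is bounded by a covering number,
  and the packing sums with an exponent above the upper box dimension are dominated by a convergent
  geometric series (\<open>packing_dim_le_upper_box_dim\<close>).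

  For the lower bound, let \<open>s\<close> be smaller than the critical exponent. It suffices to show that every
  countable cover of the attractor has a member \<open>A\<close> of infinite packing premeasure with exponent \<open>s\<close>. By
  Baire's theorem, the closure of some member \<open>A\<close> contains the part of the attractor in a cylinder
  \<open>Jw w\<close>. It remains to find in \<open>A\<close> many centres of disjoint balls of the same small radius.

  Write \<open>\<parallel>u\<parallel>\<close> for the norm of the derivative of the map of a word \<open>u\<close>. Non-negativity of the pressure
  above \<open>s\<close> and uniform contraction make the sums of \<open>\<parallel>u\<parallel> powr s'\<close> over the words of length \<open>k\<close>
  unbounded in \<open>k\<close>, for some \<open>s' > s\<close> (\<open>word_norm_sums_unbounded\<close>). By bounded distortion
  \<open>\<parallel>w v\<parallel>\<close> is comparable with \<open>\<parallel>w\<parallel> * \<parallel>v\<parallel>\<close>, and the number of words of the length of \<open>w\<close> is finite and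
  fixed, so the sums restricted to the words starting with \<open>w\<close> are unbounded as well
  (\<open>word_norm_sums_below_word_unbounded\<close>). Since \<open>s < s'\<close>, a large sum of this kind must have, at some
  scale \<open>d\<close>, many more than \<open>d powr - s\<close> terms with \<open>\<parallel>u\<parallel>\<close> about \<open>d\<close>.

  The cylinder of a word \<open>u\<close> has diameter at most of order \<open>\<parallel>u\<parallel>\<close> and contains a ball of radius of
  order \<open>\<parallel>u\<parallel>\<close> (\<open>cylinder_diameter\<close>, \<open>cylinder_inner_ball\<close>), and by the open set condition the interiors of
  different cylinders of one level are disjoint. Hence at the scale \<open>d\<close> cylinders overlap with bounded
  multiplicity (\<open>cylinder_overlap_bound\<close>), and a fixed proportion of them yields disjoint balls of radius
  \<open>d\<close> with centres in \<open>A\<close>. This makes the premeasure of \<open>A\<close> infinite (\<open>packing_premeasure_infinite\<close>).\<close>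

section \<open>Upper box dimension bounds packing dimension\<close>

lemma dyadic_level_exists:
  fixes r :: real
  assumes "0 < r" "r \<le> (1/2) ^ m"
  shows "\<exists>n\<ge>m. (1/2) ^ Suc n < r \<and> r \<le> (1/2) ^ n"
proof -
  have "\<exists>n. (1/2::real) ^ n < r"
    using assms(1) real_arch_pow_inv[of r "1/2"] by auto
  define n where "n = (LEAST n. (1/2::real) ^ n < r)"
  have n: "(1/2) ^ n < r"
    unfolding n_def using \<open>\<exists>n. _\<close> by (rule LeastI_ex)
  have "m < n"
  proof (rule ccontr)
    assume "\<not> m < n"
    then have "(1/2::real) ^ m \<le> (1/2) ^ n"
      by (intro power_decreasing) auto
    then show False using n assms(2) by linarith
  qed
  then obtain n' where n': "n = Suc n'" "m \<le> n'"
    by (metis Suc_le_D Suc_le_eq not_less_eq_eq)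
  have "\<not> (1/2::real) ^ n' < r"
    using not_less_Least[of n' "\<lambda>n. (1/2::real) ^ n < r"] n' unfolding n_def by auto
  then show ?thesis using n n' by (intro exI[of _ n']) auto
qed

text \<open>As at most \<open>L * 2 powr (n * t)\<close> of the numbers have size about \<open>2 powr - n\<close>, level \<open>n\<close>
  contributes at most \<open>L * 2 powr (n * (t - s))\<close> to the sum of their powers with exponent \<open>s > t\<close>, and
  these contributions are dominated by a geometric series. Read forwards, this bounds packing sums by
  box counts; read backwards, it is a pigeonhole principle that finds in a large sum a single scale
  carrying many terms.\<close>

lemma sum_powr_le_if_dyadic_counts_le:
  fixes \<rho> :: "'b \<Rightarrow> real"
  assumes "finite F" "0 \<le> s" "t < s" "0 \<le> L"
    and \<rho>: "\<And>x. x \<in> F \<Longrightarrow> 0 < \<rho> x \<and> \<rho> x \<le> (1/2) ^ m"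
    and count: "\<And>n. n \<ge> m \<Longrightarrow>
      real (card {x \<in> F. (1/2) ^ Suc n < \<rho> x \<and> \<rho> x \<le> (1/2) ^ n}) \<le> L * 2 powr (real n * t)"
  shows "(\<Sum>x\<in>F. \<rho> x powr s) \<le> L * (2 powr (t - s)) ^ m / (1 - 2 powr (t - s))"
proof -
  define q :: real where "q = 2 powr (t - s)"
  have q: "0 < q" "q < 1"
    using assms(3) by (auto simp: q_def powr_less_one)
  define lev where "lev x = (SOME n. n \<ge> m \<and> (1/2) ^ Suc n < \<rho> x \<and> \<rho> x \<le> (1/2) ^ n)" for x
  have lev: "lev x \<ge> m \<and> (1/2) ^ Suc (lev x) < \<rho> x \<and> \<rho> x \<le> (1/2) ^ lev x" if "x \<in> F" for x
    unfolding lev_def by (rule someI_ex) (use dyadic_level_exists \<rho> that in blast)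
  have "(\<Sum>x\<in>F. \<rho> x powr s) = (\<Sum>n\<in>lev ` F. \<Sum>x\<in>{x \<in> F. lev x = n}. \<rho> x powr s)"
    by (rule sum.image_gen[OF assms(1)])
  also have "\<dots> \<le> (\<Sum>n\<in>lev ` F. L * q ^ n)"
  proof (rule sum_mono)
    fix n assume "n \<in> lev ` F"
    then have nm: "n \<ge> m" using lev by auto
    have "(\<Sum>x\<in>{x \<in> F. lev x = n}. \<rho> x powr s)
        \<le> (\<Sum>x\<in>{x \<in> F. (1/2) ^ Suc n < \<rho> x \<and> \<rho> x \<le> (1/2) ^ n}. \<rho> x powr s)"
      by (rule sum_mono2) (use assms(1) lev in auto)
    also have "\<dots> \<le> real (card {x \<in> F. (1/2) ^ Suc n < \<rho> x \<and> \<rho> x \<le> (1/2) ^ n}) * ((1/2) ^ n) powr s"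
      by (rule sum_bounded_above) (use \<rho> assms(2) in \<open>force intro!: powr_mono2\<close>)
    also have "\<dots> \<le> (L * 2 powr (real n * t)) * ((1/2) ^ n) powr s"
      by (rule mult_right_mono[OF count[OF nm]]) simp
    also have "((1/2::real) ^ n) powr s = 2 powr (- (real n * s))"
      by (simp add: powr_minus powr_powr power_one_over powr_divide flip: powr_realpow)
        (simp add: field_simps)
    also have "(L * 2 powr (real n * t)) * \<dots> = L * q ^ n"
      by (simp add: q_def powr_add[symmetric] powr_power algebra_simps)
    finally show "(\<Sum>x\<in>{x \<in> F. lev x = n}. \<rho> x powr s) \<le> L * q ^ n" .
  qed
  also have "\<dots> = L * (\<Sum>n\<in>lev ` F. q ^ n)"
    by (simp add: sum_distrib_left)
  also have "(\<Sum>n\<in>lev ` F. q ^ n) \<le> (\<Sum>n. q ^ (n + m))"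
  proof -
    have "(\<Sum>n\<in>lev ` F. q ^ n) = (\<Sum>n\<in>(\<lambda>n. n - m) ` lev ` F. q ^ (n + m))"
    proof -
      have "inj_on (\<lambda>n. n - m) (lev ` F)"
        using lev by (intro inj_on_diff_nat) auto
      then have "(\<Sum>n\<in>(\<lambda>n. n - m) ` lev ` F. q ^ (n + m)) = (\<Sum>n\<in>lev ` F. q ^ (n - m + m))"
        by (subst sum.reindex) simp_all
      also have "\<dots> = (\<Sum>n\<in>lev ` F. q ^ n)"
        by (rule sum.cong) (use lev in auto)
      finally show ?thesis ..
    qed
    also have "\<dots> \<le> (\<Sum>n. q ^ (n + m))"
      by (rule sum_le_suminf) (use assms(1) q in \<open>auto intro: summable_geometric summable_ignore_initial_segment\<close>)
    finally show ?thesis .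
  qed
  also have "(\<Sum>n. q ^ (n + m)) = q ^ m / (1 - q)"
    using suminf_mult2[OF summable_geometric[of q], of "q ^ m"] suminf_geometric[of q] q
    by (simp add: power_add mult.commute)
  finally show ?thesis using assms(4) by (simp add: q_def mult_left_mono)
qed

lemma covering_number_cover:
  fixes F :: "'a::euclidean_space set"
  assumes "bounded F" "0 < r"
  obtains \<U> where "finite \<U>" "card \<U> = covering_number r F" "F \<subseteq> \<Union>\<U>"
    "\<And>U. U \<in> \<U> \<Longrightarrow> bounded U \<and> diameter U \<le> r"
proof -
  have "compact (closure F)" using assms(1) by (simp add: compact_closure)
  then obtain K where K: "finite K" "closure F \<subseteq> (\<Union>x\<in>K. ball x (r/2))"
    using assms(2) half_gt_zero unfolding compact_eq_totally_bounded by blast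
  have "\<exists>n \<U>. finite \<U> \<and> card \<U> = n \<and> F \<subseteq> \<Union>\<U> \<and> (\<forall>U\<in>\<U>. bounded U \<and> diameter U \<le> r)"
  proof (intro exI conjI ballI)
    show "finite ((\<lambda>x. ball x (r/2)) ` K)" using K by simp
    show "F \<subseteq> \<Union>((\<lambda>x. ball x (r/2)) ` K)" using K closure_subset[of F] by blast
    fix U assume "U \<in> (\<lambda>x. ball x (r/2)) ` K"
    then show "bounded U" "diameter U \<le> r" using assms(2) by (auto simp: diameter_ball)
  qed simp
  from LeastI_ex[OF this] show ?thesis
    using that unfolding covering_number_def by blast
qed

text \<open>A set of diameter at most \<open>r\<close> contains at most one of the separated points. The points are given by
  an indexing map, so that the bound applies to families of balls and of cylinders.\<close>

lemma card_separated_le_covering_number: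
  fixes F :: "'a::euclidean_space set"
  assumes "bounded F" "0 < r" "x ` B \<subseteq> F"
    and sep: "\<And>b b'. b \<in> B \<Longrightarrow> b' \<in> B \<Longrightarrow> b \<noteq> b' \<Longrightarrow> r < dist (x b) (x b')"
  shows "card B \<le> covering_number r F"
proof -
  obtain \<U> where \<U>: "finite \<U>" "card \<U> = covering_number r F" "F \<subseteq> \<Union>\<U>"
    "\<And>U. U \<in> \<U> \<Longrightarrow> bounded U \<and> diameter U \<le> r"
    using covering_number_cover[OF assms(1,2)] by metis
  have "\<forall>b\<in>B. \<exists>U\<in>\<U>. x b \<in> U" using \<U>(3) assms(3) by blast
  then obtain u where u: "\<And>b. b \<in> B \<Longrightarrow> u b \<in> \<U> \<and> x b \<in> u b" by metis
  have "inj_on u B"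
  proof (rule inj_onI, rule ccontr)
    fix b b' assume b: "b \<in> B" "b' \<in> B" "u b = u b'" "b \<noteq> b'"
    then have "dist (x b) (x b') \<le> diameter (u b)"
      using u[of b] u[of b'] \<U>(4) by (auto intro!: diameter_bounded_bound)
    then show False using sep[OF b(1,2,4)] \<U>(4)[of "u b"] u[OF b(1)] by linarith
  qed
  then show ?thesis
    using card_inj_on_le[of u B \<U>] u \<U> by auto
qed

lemma packing_measure_zero_if_premeasure_zero:
  fixes F :: "'a::euclidean_space set"
  assumes "packing_premeasure s F = 0"
  shows "packing_measure s F = 0"
proof -
  have empty: "packing_premeasure s ({} :: 'a set) = 0"
  proof -
    have "packings \<delta> ({} :: 'a set) = {{}}" for \<delta>
      unfolding packings_def by (auto simp: disjoint_family_on_def)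
    then show ?thesis
      by (simp add: packing_premeasure_def packing_premeasure_at_def)
  qed
  define A :: "nat \<Rightarrow> 'a set" where "A i = (if i = 0 then F else {})" for i
  have "packing_measure s F \<le> (\<Sum>i. packing_premeasure s (A i))"
    unfolding packing_measure_def by (rule INF_lower) (auto simp: A_def)
  also have "(\<lambda>i. packing_premeasure s (A i)) = (\<lambda>i. 0)"
    using assms empty by (auto simp: A_def)
  finally show ?thesis by simp
qed

text \<open>The balls of a packing whose radius is about \<open>2 powr - n\<close> have separated centres, so there are
  no more of them than sets in a covering at that scale. Summing over all scales below
  \<open>(1/2) ^ m\<close> gives a bound that tends to 0 with the mesh of the packing.\<close>

lemma packing_premeasure_zero_if_covering_numbers_le:
  fixes F :: "'a::euclidean_space set"
  assumes "bounded F" "0 \<le> t" "t < s" "0 < r0"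
    and cov: "\<And>r. 0 < r \<Longrightarrow> r < r0 \<Longrightarrow> real (covering_number r F) \<le> r powr (- t)"
  shows "packing_premeasure s F = 0"
proof -
  define q :: real where "q = 2 powr (t - s)"
  have q: "0 < q" "q < 1"
    using assms(3) by (auto simp: q_def powr_less_one)
  define K where "K = 2 powr s * (2 powr t / (1 - q))"
  have bound: "packing_premeasure s F \<le> ennreal (K * q ^ m)" if m: "(1/2) ^ m < r0" for m
  proof -
    have "packing_premeasure s F \<le> packing_premeasure_at s ((1/2) ^ m) F"
      unfolding packing_premeasure_def by (rule INF_lower) simp
    also have "\<dots> \<le> ennreal (K * q ^ m)"
      unfolding packing_premeasure_at_def
    proof (rule SUP_least)
      fix B assume B: "B \<in> packings ((1/2) ^ m) F"
      have Bin: "x \<in> F \<and> 0 < r \<and> r \<le> (1/2) ^ m" if "(x, r) \<in> B" for x r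
        using B that by (auto simp: packings_def)
      have disj: "cball (fst b) (snd b) \<inter> cball (fst b') (snd b') = {}"
        if "b \<in> B" "b' \<in> B" "b \<noteq> b'" for b b'
        using B that unfolding packings_def disjoint_family_on_def
        by (auto simp: case_prod_unfold)
      have "(\<Sum>(x, r)\<in>G. ennreal ((2 * r) powr s)) \<le> ennreal (K * q ^ m)"
        if G: "finite G" "G \<subseteq> B" for G
      proof -
        have "(\<Sum>b\<in>G. snd b powr s) \<le> 2 powr t * (2 powr (t - s)) ^ m / (1 - 2 powr (t - s))"
        proof (rule sum_powr_le_if_dyadic_counts_le)
          show "finite G" "0 \<le> s" "t < s" using G assms by auto
          show "0 < snd b \<and> snd b \<le> (1/2) ^ m" if "b \<in> G" for b
            using Bin[of "fst b" "snd b"] G that by auto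
          fix n assume n: "m \<le> n"
          let ?Gn = "{b \<in> G. (1/2) ^ Suc n < snd b \<and> snd b \<le> (1/2) ^ n}"
          \<comment> \<open>The centre of one ball lies outside the other, so two centres are more than
            \<open>(1/2) ^ Suc n\<close> apart; counting at level \<open>Suc n\<close> costs the factor \<open>2 powr t\<close>.\<close>
          have "card ?Gn \<le> covering_number ((1/2) ^ Suc n) F"
          proof (rule card_separated_le_covering_number[where x = fst])
            show "fst ` ?Gn \<subseteq> F" using Bin G by fastforce
            fix b b' assume b: "b \<in> ?Gn" "b' \<in> ?Gn" "b \<noteq> b'"
            then have "b \<in> B" "b' \<in> B" "fst b' \<in> cball (fst b') (snd b')"
              using Bin[of "fst b'" "snd b'"] G by auto
            then have "fst b' \<notin> cball (fst b) (snd b)"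
              using disj[of b b'] b(3) by blast
            then show "(1/2) ^ Suc n < dist (fst b) (fst b')"
              using b by auto
          qed (use assms in auto)
          then have "real (card ?Gn) \<le> real (covering_number ((1/2) ^ Suc n) F)" by simp
          also have "\<dots> \<le> ((1/2) ^ Suc n) powr (- t)"
          proof (rule cov)
            have "(1/2::real) ^ Suc n \<le> (1/2) ^ m"
              using n by (intro power_decreasing) auto
            then show "(1/2) ^ Suc n < r0" using m by simp
          qed simp
          also have "((1/2::real) ^ Suc n) powr (- t) = (2 powr (- real (Suc n))) powr (- t)"
            by (simp add: powr_minus powr_realpow power_one_over inverse_eq_divide
                del: of_nat_Suc power_Suc)
          also have "\<dots> = 2 powr t * 2 powr (real n * t)"
            by (simp add: powr_powr powr_add[symmetric] algebra_simps)
          finally show "real (card ?Gn) \<le> 2 powr t * 2 powr (real n * t)" .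
        qed simp
        then have le: "2 powr s * (\<Sum>b\<in>G. snd b powr s) \<le> K * q ^ m"
          unfolding K_def q_def by (drule_tac mult_left_mono[where c = "2 powr s"]) (simp_all add: mult.assoc)
        have "(\<Sum>(x, r)\<in>G. ennreal ((2 * r) powr s)) = ennreal (\<Sum>b\<in>G. (2 * snd b) powr s)"
          by (simp add: case_prod_unfold)
        also have "(\<Sum>b\<in>G. (2 * snd b) powr s) = 2 powr s * (\<Sum>b\<in>G. snd b powr s)"
          unfolding sum_distrib_left
        proof (rule sum.cong)
          fix b assume "b \<in> G"
          then have "0 < snd b" using Bin[of "fst b" "snd b"] G by auto
          then show "(2 * snd b) powr s = 2 powr s * snd b powr s"
            by (simp add: powr_mult)
        qed simp
        finally show ?thesis using le by (simp add: ennreal_leI)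
      qed
      then show "(\<Sum>\<^sub>\<infinity>(x, r)\<in>B. ennreal ((2 * r) powr s)) \<le> ennreal (K * q ^ m)"
        by (intro infsum_le_finite_sums nonneg_summable_on_complete) auto
    qed
    finally show ?thesis .
  qed
  have "(\<lambda>m. ennreal (K * q ^ m)) \<longlonglongrightarrow> ennreal (K * 0)"
    by (intro tendsto_ennrealI tendsto_intros LIMSEQ_realpow_zero) (use q in auto)
  moreover have "\<forall>\<^sub>F m in sequentially. packing_premeasure s F \<le> ennreal (K * q ^ m)"
  proof -
    have "(\<lambda>m. (1/2::real) ^ m) \<longlonglongrightarrow> 0" by (intro LIMSEQ_realpow_zero) auto
    then have "\<forall>\<^sub>F m in sequentially. (1/2::real) ^ m < r0"
      using assms(4) by (rule order_tendstoD)
    then show ?thesis by eventually_elim (rule bound)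
  qed
  ultimately have "packing_premeasure s F \<le> ennreal (K * 0)"
    by (intro tendsto_lowerbound) auto
  then show ?thesis by simp
qed

lemma upper_box_dim_nonneg:
  fixes F :: "'a::euclidean_space set"
  assumes "bounded F" "F \<noteq> {}"
  shows "0 \<le> upper_box_dim F"
  unfolding upper_box_dim_def
proof (rule le_Limsup)
  have "\<forall>\<^sub>F r in at_right (0::real). 0 < r \<and> r < 1"
    using eventually_at_right_less[of "0::real"] eventually_at_right_real[of 0 "1::real"]
    by (auto elim: eventually_elim2)
  then show "\<forall>\<^sub>F r in at_right 0. 0 \<le> ereal (ln (real (covering_number r F)) / - ln r)"
  proof eventually_elim
    case (elim r)
    obtain x where "x \<in> F" using assms(2) by auto
    then have "1 \<le> covering_number r F"
      using card_separated_le_covering_number[of F r "\<lambda>_. x" "{()}"] assms elim by auto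
    moreover have "0 \<le> - ln r" using elim by simp
    ultimately have "0 \<le> ln (real (covering_number r F)) / - ln r"
      by (intro divide_nonneg_nonneg) auto
    then show ?case by (simp add: zero_ereal_def)
  qed
qed simp

lemma packing_dim_le_upper_box_dim:
  fixes F :: "'a::euclidean_space set"
  assumes "bounded F" "F \<noteq> {}"
  shows "packing_dim F \<le> upper_box_dim F"
proof (rule ccontr)
  assume "\<not> packing_dim F \<le> upper_box_dim F"
  then obtain s where s: "upper_box_dim F < ereal s" "ereal s < packing_dim F"
    using ereal_dense2[of "upper_box_dim F" "packing_dim F"] by (auto simp: not_le)
  from ereal_dense2[OF s(1)] obtain t where t: "upper_box_dim F < ereal t" "ereal t < ereal s"
    by auto
  have t0: "0 < t"
    using upper_box_dim_nonneg[OF assms] t(1) by (metis ereal_less(2) le_less_trans)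
  have "\<forall>\<^sub>F r in at_right 0. ereal (ln (real (covering_number r F)) / - ln r) < ereal t"
    using t(1) unfolding upper_box_dim_def by (rule Limsup_lessD)
  then obtain b where b: "b > 0"
    "\<And>r. 0 < r \<Longrightarrow> r < b \<Longrightarrow> ln (real (covering_number r F)) / - ln r < t"
    unfolding eventually_at_right_field by auto
  have "packing_premeasure s F = 0"
  proof (rule packing_premeasure_zero_if_covering_numbers_le)
    show "bounded F" "0 \<le> t" "t < s" "0 < min b 1"
      using assms t t0 b by auto
    fix r assume r: "0 < r" "r < min b 1"
    then have "ln (real (covering_number r F)) < t * (- ln r)"
      using b(2)[of r] by (simp add: field_simps)
    then show "real (covering_number r F) \<le> r powr (- t)"
    proof (cases "covering_number r F = 0")
      case False
      then have "real (covering_number r F) = exp (ln (real (covering_number r F)))" by simp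
      also have "\<dots> \<le> exp (t * (- ln r))"
        using \<open>ln (real (covering_number r F)) < t * (- ln r)\<close> by (subst exp_le_cancel_iff) simp
      also have "\<dots> = r powr (- t)" using r by (simp add: powr_def)
      finally show ?thesis .
    qed simp
  qed
  then have "packing_measure s F = 0"
    by (rule packing_measure_zero_if_premeasure_zero)
  then have "packing_dim F \<le> ereal s"
    unfolding packing_dim_def using t0 t by (intro Inf_lower) auto
  then show False using s(2) by simp
qed


section \<open>Geometry of maps with controlled derivative\<close>

text \<open>A volume-type bound: after rescaling by \<open>1 / d\<close>, the set is \<open>\<rho>\<close>-separated in a fixed ball, so one
  constant serves for all scales \<open>d\<close>.\<close>

lemma card_separated_bounded:
  fixes \<rho> R :: real
  assumes "0 < \<rho>"
  obtains N :: nat where "\<And>(x :: 'a::euclidean_space) d S. 0 < d \<Longrightarrow> finite S \<Longrightarrow> S \<subseteq> cball x (R * d) \<Longrightarrow>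
    (\<And>y z. y \<in> S \<Longrightarrow> z \<in> S \<Longrightarrow> y \<noteq> z \<Longrightarrow> \<rho> * d < dist y z) \<Longrightarrow> card S \<le> N"
proof
  fix x :: 'a and d S
  assume d: "0 < d" and S: "finite S" "S \<subseteq> cball x (R * d)"
    and sep: "\<And>y z. y \<in> S \<Longrightarrow> z \<in> S \<Longrightarrow> y \<noteq> z \<Longrightarrow> \<rho> * d < dist y z"
  let ?h = "\<lambda>y. (1 / d) *\<^sub>R (y - x)"
  show "card S \<le> covering_number \<rho> (cball (0::'a) R)"
  proof (rule card_separated_le_covering_number[where x = ?h])
    show "?h ` S \<subseteq> cball 0 R"
    proof
      fix w assume "w \<in> ?h ` S"
      then obtain y where y: "y \<in> S" "w = ?h y" by blast
      then have "norm (y - x) \<le> R * d"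
        using S(2) by (auto simp: dist_norm norm_minus_commute)
      then show "w \<in> cball 0 R" using y d by (simp add: divide_simps)
    qed
    fix y z assume yz: "y \<in> S" "z \<in> S" "y \<noteq> z"
    have "dist (?h y) (?h z) = dist y z / d"
      using d by (simp add: dist_norm flip: scaleR_diff_right)
    moreover have "\<rho> < dist y z / d"
      using sep[OF yz] d by (simp add: pos_less_divide_eq)
    ultimately show "\<rho> < dist (?h y) (?h z)" by simp
  qed (use assms in auto)
qed

text \<open>The set \<open>J\<close> need not be convex, nor even connected, so the mean value inequality does not apply to
  it directly. Any two points of the connected open set \<open>V\<close> are joined by a chain of balls in \<open>V\<close>,
  and along a chain displacements add up; by compactness of \<open>J\<close> a bounded total length suffices. The
  constant depends only on \<open>V\<close> and \<open>J\<close>, not on the map.\<close>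

lemma displacement_le_of_derivative_bound:
  fixes V J :: "'a::euclidean_space set"
  assumes "open V" "connected V" "compact J" "J \<subseteq> V"
  obtains K where "K > 0"
    "\<And>(f :: 'a \<Rightarrow> 'a) f' M x y. (\<And>x. x \<in> V \<Longrightarrow> (f has_derivative f' x) (at x)) \<Longrightarrow>
       (\<And>x. x \<in> V \<Longrightarrow> onorm (f' x) \<le> M) \<Longrightarrow> x \<in> J \<Longrightarrow> y \<in> J \<Longrightarrow> dist (f x) (f y) \<le> K * M"
proof -
  \<comment> \<open>\<open>Q x y K\<close> says that \<open>x\<close> and \<open>y\<close> are at effective distance at most \<open>K\<close> inside \<open>V\<close>, tested on all
    maps simultaneously. Being at finite effective distance is an equivalence relation with open
    classes.\<close>
  define adm :: "('a \<Rightarrow> 'a) \<Rightarrow> real \<Rightarrow> bool" where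
    "adm f M \<longleftrightarrow> (\<exists>f'. (\<forall>x\<in>V. (f has_derivative f' x) (at x)) \<and> (\<forall>x\<in>V. onorm (f' x) \<le> M))" for f M
  define Q where "Q x y K \<longleftrightarrow> (\<forall>f M. adm f M \<longrightarrow> dist (f x) (f y) \<le> K * M)" for x y K
  have Q_sym: "Q x y K \<Longrightarrow> Q y x K" for x y K
    unfolding Q_def by (simp add: dist_commute)
  have Q_trans: "Q x z (K + K')" if "Q x y K" "Q y z K'" for x y z K K'
    unfolding Q_def
  proof (intro allI impI)
    fix f M assume "adm f M"
    then have "dist (f x) (f y) \<le> K * M" "dist (f y) (f z) \<le> K' * M"
      using that unfolding Q_def by auto
    then show "dist (f x) (f z) \<le> (K + K') * M"
      using dist_triangle[of "f x" "f z" "f y"] by (simp add: algebra_simps)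
  qed
  have M_nonneg: "0 \<le> M" if "adm f M" "x \<in> V" for f M x
    using that onorm_pos_le has_derivative_bounded_linear order_trans unfolding adm_def by blast
  have Q_mono: "Q x y K'" if "Q x y K" "K \<le> K'" "x \<in> V" for x y K K'
    using that M_nonneg unfolding Q_def by (meson mult_right_mono order_trans)
  have ball: "Q x y e" if "ball x e \<subseteq> V" "y \<in> ball x e" for x y e
    unfolding Q_def
  proof (intro allI impI)
    fix f M assume adm: "adm f M"
    then obtain f' where f': "\<And>x. x \<in> V \<Longrightarrow> (f has_derivative f' x) (at x)"
      "\<And>x. x \<in> V \<Longrightarrow> onorm (f' x) \<le> M" unfolding adm_def by blast
    have e: "x \<in> ball x e" using that(2) by (auto intro: le_less_trans[OF zero_le_dist])
    have "norm (f x - f y) \<le> M * norm (x - y)"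
    proof (rule differentiable_bound[of "ball x e" f f'])
      fix z assume "z \<in> ball x e"
      then have "z \<in> V" using that(1) by blast
      then show "(f has_derivative f' z) (at z within ball x e)" "onorm (f' z) \<le> M"
        using f' by (auto intro: has_derivative_at_withinI)
    qed (use that(2) e in auto)
    also have "\<dots> \<le> M * e"
    proof (rule mult_left_mono)
      show "norm (x - y) \<le> e" using that(2) by (simp add: dist_norm)
      show "0 \<le> M" using M_nonneg[OF adm] that(1) e by blast
    qed
    finally show "dist (f x) (f y) \<le> e * M" by (simp add: dist_norm mult.commute)
  qed
  have chain: "\<exists>K. Q x y K" if "x \<in> V" "y \<in> V" for x y
  proof (rule connected_equivalence_relation[OF assms(2) that])
    fix a assume "a \<in> V"
    then obtain e where e: "e > 0" "ball a e \<subseteq> V"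
      using assms(1) open_contains_ball by blast
    then show "\<exists>T. openin (top_of_set V) T \<and> a \<in> T \<and> (\<forall>x\<in>T. \<exists>K. Q a x K)"
      by (intro exI[of _ "ball a e"]) (auto intro: ball open_subset)
  qed (use Q_sym Q_trans in blast)+
  show ?thesis
  proof (cases "J = {}")
    case True
    then show ?thesis using that[of 1] by auto
  next
    case False
    then obtain x0 where x0: "x0 \<in> J" by auto
    have "\<forall>x\<in>J. \<exists>e>0. ball x e \<subseteq> V"
      using assms(1,4) open_contains_ball by blast
    then obtain e where e: "\<And>x. x \<in> J \<Longrightarrow> e x > 0 \<and> ball x (e x) \<subseteq> V" by metis
    obtain D where D: "finite D" "D \<subseteq> J" "J \<subseteq> (\<Union>x\<in>D. ball x (e x))"
    proof (rule compactE_image[OF assms(3), of J "\<lambda>x. ball x (e x)"])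
      show "J \<subseteq> (\<Union>x\<in>J. ball x (e x))"
      proof
        fix x assume "x \<in> J"
        then show "x \<in> (\<Union>x\<in>J. ball x (e x))" using e[of x] by (intro UN_I[of x]) auto
      qed
    qed auto
    have "\<forall>x\<in>J. \<exists>k. Q x0 x k" using chain x0 assms(4) by blast
    then obtain k where k: "\<And>x. x \<in> J \<Longrightarrow> Q x0 x (k x)" by metis
    define K where "K = (\<Sum>x\<in>D. \<bar>k x\<bar> + e x)"
    have nonneg: "0 \<le> \<bar>k x\<bar> + e x" if "x \<in> D" for x
      using e[of x] D(2) that by (simp add: subset_iff add_nonneg_nonneg order_less_imp_le)
    have K: "Q x0 y K" if y: "y \<in> J" for y
    proof -
      obtain x where x: "x \<in> D" "y \<in> ball x (e x)" using D y by blast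
      have "Q x0 y (k x + e x)"
        using Q_trans[OF k ball] x D(2) e by blast
      moreover have "k x + e x \<le> K"
        unfolding K_def using D(1) nonneg
        by (intro order_trans[OF _ member_le_sum[OF x(1)]]) auto
      ultimately show ?thesis using Q_mono x0 assms(4) by blast
    qed
    have K0: "0 \<le> K"
      unfolding K_def using nonneg by (intro sum_nonneg) auto
    show ?thesis
    proof (rule that[of "K + K + 1"])
      show "0 < K + K + 1" using K0 by simp
      fix f :: "'a \<Rightarrow> 'a" and f' M x y
      assume f: "\<And>x. x \<in> V \<Longrightarrow> (f has_derivative f' x) (at x)" "\<And>x. x \<in> V \<Longrightarrow> onorm (f' x) \<le> M"
        and xy: "x \<in> J" "y \<in> J"
      have "Q x y (K + K + 1)"
        using Q_mono[OF Q_trans[OF Q_sym[OF K] K], of x y "K + K + 1"] xy assms(4) by auto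
      moreover have "adm f M" unfolding adm_def using f by blast
      ultimately show "dist (f x) (f y) \<le> (K + K + 1) * M" unfolding Q_def by blast
    qed
  qed
qed

text \<open>A quantitative form of the inverse function theorem. The image is open by invariance of
  domain, and the inverse map has derivative of norm at most \<open>1 / \<mu>\<close>, so a boundary point of the image at distance less than \<open>\<mu> * r\<close> from \<open>f x\<close> would itself be the image of
  a point of the ball, which contradicts openness.\<close>

lemma ball_subset_image_of_expanding_derivative:
  fixes f :: "'a::euclidean_space \<Rightarrow> 'a"
  assumes "0 < \<mu>" "0 < r" "inj_on f (ball x r)"
    and f': "\<And>z. z \<in> ball x r \<Longrightarrow> (f has_derivative f' z) (at z)"
    and expand: "\<And>z v. z \<in> ball x r \<Longrightarrow> \<mu> * norm v \<le> norm (f' z v)"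
  shows "ball (f x) (\<mu> * r) \<subseteq> f ` ball x r"
proof (rule subsetI, rule ccontr)
  let ?U = "f ` ball x r"
  fix y assume y: "y \<in> ball (f x) (\<mu> * r)" "y \<notin> ?U"
  have cont: "continuous_on (ball x r) f"
    using f' has_derivative_continuous continuous_at_imp_continuous_on by blast
  have "open ?U"
    by (rule invariance_of_domain[OF cont open_ball assms(3)])
  \<comment> \<open>The largest ball about \<open>f x\<close> inside the image touches the complement at a point \<open>p\<close>.\<close>
  define R where "R = infdist (f x) (- ?U)"
  obtain p where p: "p \<in> - ?U" "R = dist (f x) p"
    using infdist_attains_inf[of "- ?U" "f x"] \<open>open ?U\<close> y(2) unfolding R_def by blast
  have "R \<le> dist (f x) y" unfolding R_def using y by (intro infdist_le) auto
  then have R: "R < \<mu> * r" using y by auto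
  have "p \<noteq> f x" using p assms(2) by auto
  then have R0: "0 < R" using p by simp
  have sub: "ball (f x) R \<subseteq> ?U"
  proof
    fix w assume "w \<in> ball (f x) R"
    then show "w \<in> ?U" using infdist_le[of w "- ?U" "f x"] unfolding R_def by auto
  qed
  define g where "g = inv_into (ball x r) f"
  have gf: "g (f z) = z" if "z \<in> ball x r" for z
    unfolding g_def using assms(3) that by (rule inv_into_f_f)
  have fg: "f (g w) = w" "g w \<in> ball x r" if "w \<in> ?U" for w
    unfolding g_def using f_inv_into_f[OF that] inv_into_into[OF that] by auto
  have g': "(g has_derivative inv (f' (g w))) (at w) \<and> onorm (inv (f' (g w))) \<le> 1 / \<mu>"
    if w: "w \<in> ?U" for w
  proof -
    let ?L = "f' (g w)"
    have lin: "linear ?L" using f'[OF fg(2)[OF w]] by (rule has_derivative_linear)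
    have "inj ?L"
    proof (rule linear_injective_0[THEN iffD2, OF lin], intro allI impI)
      fix v assume "?L v = 0"
      then show "v = 0" using expand[OF fg(2)[OF w], of v] assms(1)
        by (simp add: mult_le_0_iff)
    qed
    then have "surj ?L" using lin linear_injective_imp_surjective by blast
    have comp: "?L \<circ> inv ?L = id" using \<open>surj ?L\<close> by (simp add: surj_iff)
    have "(g has_derivative inv (f' (g w))) (at (f (g w)))"
      by (rule has_derivative_inverse_on[OF open_ball f' gf, where g' = "\<lambda>z. inv (f' z)"])
        (use comp fg w in auto)
    moreover have "onorm (inv ?L) \<le> 1 / \<mu>"
    proof (rule onorm_bound)
      fix v
      have "\<mu> * norm (inv ?L v) \<le> norm (?L (inv ?L v))" by (rule expand[OF fg(2)[OF w]])
      also have "?L (inv ?L v) = v" using \<open>surj ?L\<close> by (rule surj_f_inv_f)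
      finally show "norm (inv ?L v) \<le> 1 / \<mu> * norm v" using assms(1) by (simp add: field_simps)
    qed (use assms in simp)
    ultimately show ?thesis using fg w by simp
  qed
  \<comment> \<open>On this ball, which is convex, the inverse map is Lipschitz with constant \<open>1 / \<mu>\<close>. Hence the
    ball lies in the image of a compact subset of the domain, and so does \<open>p\<close>.\<close>
  have "ball (f x) R \<subseteq> f ` cball x (R / \<mu>)"
  proof
    fix w assume w: "w \<in> ball (f x) R"
    have "norm (g w - g (f x)) \<le> 1 / \<mu> * norm (w - f x)"
    proof (rule differentiable_bound[of "ball (f x) R" g "\<lambda>w. inv (f' (g w))"])
      fix y assume "y \<in> ball (f x) R"
      then have "y \<in> ?U" using sub by blast
      then show "(g has_derivative inv (f' (g y))) (at y within ball (f x) R)"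
        "onorm (inv (f' (g y))) \<le> 1 / \<mu>"
        using g' by (auto intro: has_derivative_at_withinI)
    qed (use w R0 in auto)
    also have "\<dots> \<le> 1 / \<mu> * R"
      using w assms(1) by (intro mult_left_mono) (auto simp: dist_norm norm_minus_commute)
    finally have "g w \<in> cball x (R / \<mu>)"
      using gf[of x] assms(2) by (simp add: dist_norm norm_minus_commute)
    then show "w \<in> f ` cball x (R / \<mu>)" using fg(1) sub w by (metis imageI subsetD)
  qed
  moreover have dom: "cball x (R / \<mu>) \<subseteq> ball x r"
  proof
    fix z assume "z \<in> cball x (R / \<mu>)"
    moreover have "R / \<mu> < r" using R assms(1) by (simp add: pos_divide_less_eq mult.commute)
    ultimately show "z \<in> ball x r" by simp
  qed
  moreover have "compact (f ` cball x (R / \<mu>))"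
    using dom by (intro compact_continuous_image continuous_on_subset[OF cont]) auto
  ultimately have "closure (ball (f x) R) \<subseteq> f ` cball x (R / \<mu>)"
    by (intro closure_minimal compact_imp_closed)
  then have "cball (f x) R \<subseteq> ?U" using R0 dom by (auto simp: closure_ball)
  then show False using p by auto
qed

section \<open>Conformal maps and their scaling factors\<close>

lemma scaling_factor_eq:
  fixes L :: "'a::euclidean_space \<Rightarrow> 'a"
  assumes "\<And>v. norm (L v) = \<rho> * norm v"
  shows "scaling_factor L = \<rho>"
  unfolding scaling_factor_def
proof (rule the_equality)
  fix \<rho>' assume "\<forall>v. norm (L v) = \<rho>' * norm v"
  moreover obtain b :: 'a where "b \<in> Basis" using nonempty_Basis by blast
  ultimately have "norm (L b) = \<rho>'" "norm (L b) = \<rho>" using assms by auto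
  then show "\<rho>' = \<rho>" by simp
qed (use assms in simp)

definition conformal_at :: "('a::euclidean_space \<Rightarrow> 'a) \<Rightarrow> 'a \<Rightarrow> bool" where
  "conformal_at f x \<longleftrightarrow> (\<exists>L. (f has_derivative L) (at x) \<and> similarity_linear L)"

lemma conformal_atD:
  assumes "conformal_at f x"
  shows "(f has_derivative frechet_derivative f (at x)) (at x)"
    "norm (frechet_derivative f (at x) v) = deriv_scale f x * norm v"
    "0 < deriv_scale f x"
    "onorm (frechet_derivative f (at x)) \<le> deriv_scale f x"
proof -
  obtain L where L: "(f has_derivative L) (at x)" "similarity_linear L"
    using assms unfolding conformal_at_def by blast
  have eq: "frechet_derivative f (at x) = L" using frechet_derivative_at[OF L(1)] by simp
  obtain \<rho> where \<rho>: "\<rho> > 0" "\<And>v. norm (L v) = \<rho> * norm v"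
    using L(2) unfolding similarity_linear_def by blast
  have "deriv_scale f x = \<rho>" unfolding deriv_scale_def eq by (rule scaling_factor_eq[OF \<rho>(2)])
  then show "(f has_derivative frechet_derivative f (at x)) (at x)"
    "norm (frechet_derivative f (at x) v) = deriv_scale f x * norm v" "0 < deriv_scale f x"
    "onorm (frechet_derivative f (at x)) \<le> deriv_scale f x"
    using L(1) \<rho> eq by (auto intro!: onorm_bound)
qed

lemma deriv_scale_eqI:
  assumes "(f has_derivative L) (at x)" "\<And>v. norm (L v) = \<rho> * norm v"
  shows "deriv_scale f x = \<rho>"
  unfolding deriv_scale_def using frechet_derivative_at[OF assms(1)] scaling_factor_eq[OF assms(2)]
  by simp

lemma conformal_at_id: "conformal_at id x" and deriv_scale_id: "deriv_scale id x = 1"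
proof -
  have "(id has_derivative id) (at x)" by (simp add: id_def)
  then show "conformal_at id x"
    unfolding conformal_at_def similarity_linear_def by (intro exI[of _ id] conjI) (auto intro: exI[of _ 1] simp: linear_id)
  show "deriv_scale id x = 1"
    by (rule deriv_scale_eqI[of _ id]) (simp_all add: id_def)
qed

lemma
  assumes "conformal_at f (g x)" "conformal_at g x"
  shows conformal_at_compose: "conformal_at (f \<circ> g) x"
    and deriv_scale_compose: "deriv_scale (f \<circ> g) x = deriv_scale f (g x) * deriv_scale g x"
proof -
  let ?F = "frechet_derivative f (at (g x))" and ?G = "frechet_derivative g (at x)"
  have d: "((f \<circ> g) has_derivative (?F \<circ> ?G)) (at x)"
    by (rule diff_chain_at) (rule conformal_atD assms)+
  have n: "norm ((?F \<circ> ?G) v) = (deriv_scale f (g x) * deriv_scale g x) * norm v" for v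
    using conformal_atD(2)[OF assms(1)] conformal_atD(2)[OF assms(2)] by simp
  have "0 < deriv_scale f (g x) * deriv_scale g x"
    using conformal_atD(3)[OF assms(1)] conformal_atD(3)[OF assms(2)] by simp
  then show "conformal_at (f \<circ> g) x"
    unfolding conformal_at_def similarity_linear_def
    using d n has_derivative_linear[OF d] by blast
  show "deriv_scale (f \<circ> g) x = deriv_scale f (g x) * deriv_scale g x"
    by (rule deriv_scale_eqI[OF d n])
qed

lemma deriv_scale_le_of_lipschitz:
  fixes f :: "'a::euclidean_space \<Rightarrow> 'a"
  assumes "conformal_at f x" "x \<in> interior S"
    and lip: "\<And>y. y \<in> S \<Longrightarrow> norm (f y - f x) \<le> K * norm (y - x)"
  shows "deriv_scale f x \<le> K"
proof (rule ccontr)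
  let ?D = "frechet_derivative f (at x)"
  assume "\<not> deriv_scale f x \<le> K"
  then have e: "0 < (deriv_scale f x - K) / 2" by simp
  obtain d where d: "d > 0" "\<And>y. norm (y - x) < d \<Longrightarrow>
      norm (f y - f x - ?D (y - x)) \<le> (deriv_scale f x - K) / 2 * norm (y - x)"
    using conformal_atD(1)[OF assms(1)] e unfolding has_derivative_at_alt by metis
  obtain d' where d': "d' > 0" "ball x d' \<subseteq> S" using assms(2) mem_interior by blast
  obtain b :: 'a where b: "b \<in> Basis" using nonempty_Basis by blast
  define h where "h = min d d' / 2"
  define y where "y = x + h *\<^sub>R b"
  have h: "0 < h" "h < d" "h < d'" using d d' unfolding h_def by auto
  have y: "norm (y - x) = h" using h b by (simp add: y_def)
  have "y \<in> S" using d' h y by (auto simp: dist_norm norm_minus_commute)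
  have "deriv_scale f x * h = norm (?D (y - x))" using conformal_atD(2)[OF assms(1)] y by simp
  also have "\<dots> \<le> norm (f y - f x) + norm (f y - f x - ?D (y - x))"
    using norm_triangle_sub[of "?D (y - x)" "f y - f x"] by (simp add: norm_minus_commute)
  also have "\<dots> \<le> K * h + (deriv_scale f x - K) / 2 * h"
    using lip[OF \<open>y \<in> S\<close>] d(2)[of y] y h by auto
  finally have "(deriv_scale f x - K) / 2 * h \<le> 0" by (simp add: field_simps)
  then show False using e h by (simp add: mult_le_0_iff)
qed


section \<open>Words\<close>

lemma words_Cons:
  "i # u \<in> words I l k \<longleftrightarrow> l \<le> k \<and> i \<in> I l \<and> u \<in> words I (Suc l) k"
  by (auto simp: words_def nth_Cons less_Suc_eq_0_disj)

lemma words_append: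
  assumes "m \<le> k"
  shows "w @ v \<in> words I 1 k \<and> length w = m \<longleftrightarrow> w \<in> words I 1 m \<and> v \<in> words I (Suc m) k"
proof -
  have "(\<forall>j<length (w @ v). (w @ v) ! j \<in> I (1 + j)) \<longleftrightarrow>
      (\<forall>j<length w. w ! j \<in> I (1 + j)) \<and> (\<forall>j<length v. v ! j \<in> I (Suc (length w) + j))"
  proof (intro iffI conjI allI impI)
    fix j assume *: "\<forall>j<length (w @ v). (w @ v) ! j \<in> I (1 + j)"
    show "w ! j \<in> I (1 + j)" if "j < length w"
      using *[rule_format, of j] that by (simp add: nth_append)
    show "v ! j \<in> I (Suc (length w) + j)" if "j < length v"
      using *[rule_format, of "length w + j"] that by simp
  next
    fix j assume *: "(\<forall>j<length w. w ! j \<in> I (1 + j)) \<and> (\<forall>j<length v. v ! j \<in> I (Suc (length w) + j))"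
      and "j < length (w @ v)"
    then show "(w @ v) ! j \<in> I (1 + j)"
      using *[THEN conjunct1, rule_format, of j] *[THEN conjunct2, rule_format, of "j - length w"]
      by (cases "j < length w") (simp_all add: nth_append)
  qed
  then show ?thesis
    using assms by (auto simp: words_def)
qed

lemma words_take_drop:
  assumes "u \<in> words I 1 k" "m \<le> k"
  shows "take m u \<in> words I 1 m" "drop m u \<in> words I (Suc m) k"
  using words_append[OF assms(2), of "take m u" "drop m u" I] assms by (auto simp: words_def)

lemma word_map_append:
  "word_map \<phi> l (w @ v) = word_map \<phi> l w \<circ> word_map \<phi> (l + length w) v"
  by (induction w arbitrary: l) (auto simp: comp_assoc)

lemma finite_words:
  assumes "\<And>j. l \<le> j \<Longrightarrow> finite (I j)"
  shows "finite (words I l k)"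
proof (rule finite_subset)
  show "words I l k \<subseteq> {u. set u \<subseteq> (\<Union>j\<in>{l..k}. I j) \<and> length u = k + 1 - l}"
  proof
    fix u assume u: "u \<in> words I l k"
    have "set u \<subseteq> (\<Union>j\<in>{l..k}. I j)"
    proof
      fix i assume "i \<in> set u"
      then obtain j where "j < length u" "i = u ! j" by (auto simp: in_set_conv_nth)
      then show "i \<in> (\<Union>j\<in>{l..k}. I j)"
        using u by (intro UN_I[of "l + j"]) (auto simp: words_def)
    qed
    then show "u \<in> {u. set u \<subseteq> (\<Union>j\<in>{l..k}. I j) \<and> length u = k + 1 - l}"
      using u by (simp add: words_def)
  qed
  show "finite {u. set u \<subseteq> (\<Union>j\<in>{l..k}. I j) \<and> length u = k + 1 - l}"
    using assms by (intro finite_lists_length_eq) auto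
qed

section \<open>Geometry of the cylinders of a conformal system\<close>

lemma conformal_diffeo_conformal_at:
  assumes "conformal_diffeo_into V f" "x \<in> V"
  shows "conformal_at f x"
proof -
  obtain f' :: "'a \<Rightarrow> 'a \<Rightarrow>\<^sub>L 'a" where "(f has_derivative blinfun_apply (f' x)) (at x)"
    using assms unfolding conformal_diffeo_into_def C1_on_def by blast
  moreover from this have "blinfun_apply (f' x) = frechet_derivative f (at x)"
    by (rule frechet_derivative_at)
  ultimately show ?thesis
    using assms unfolding conformal_diffeo_into_def conformal_at_def by auto
qed

text \<open>The constants of the system are fixed here, so that later bounds refer to one choice:
  \<open>V\<close> carries the conformal extensions, \<open>C\<close> is the
  distortion constant and \<open>c\<close> the uniform contraction ratio.\<close>

locale conformal_ifs =
  fixes I :: "nat \<Rightarrow> 'i set"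
    and J :: "'a::euclidean_space set"
    and \<phi> :: "nat \<Rightarrow> 'i \<Rightarrow> 'a \<Rightarrow> 'a"
    and Jw :: "'i list \<Rightarrow> 'a set"
    and V :: "'a set"
    and C c :: real
  assumes ifs: "nonautonomous_ifs I J \<phi> Jw"
    and osc: "open_set_condition I Jw"
    and V: "open V" "connected V" "J \<subseteq> V"
    and maps: "\<And>k i. 1 \<le> k \<Longrightarrow> i \<in> I k \<Longrightarrow> conformal_diffeo_into V (\<phi> k i)"
    and C: "1 \<le> C"
    and distortion_nonempty: "\<And>l k u x y. 1 \<le> l \<Longrightarrow> l \<le> k \<Longrightarrow> u \<in> words I l k \<Longrightarrow> x \<in> V \<Longrightarrow> y \<in> V \<Longrightarrow>
      deriv_scale (word_map \<phi> l u) x \<le> C * deriv_scale (word_map \<phi> l u) y"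
    and c: "0 < c" "c < 1"
    and contraction: "\<And>k i x y. 1 \<le> k \<Longrightarrow> i \<in> I k \<Longrightarrow> x \<in> J \<Longrightarrow> y \<in> J \<Longrightarrow>
      norm (\<phi> k i x - \<phi> k i y) \<le> c * norm (x - y)"
begin

abbreviation E :: "'a set" where
  "E \<equiv> attractor I Jw"

definition word_norm :: "nat \<Rightarrow> 'i list \<Rightarrow> real" where
  "word_norm l u = deriv_norm J (word_map \<phi> l u)"

lemma index_sets: "1 \<le> k \<Longrightarrow> finite (I k)" "1 \<le> k \<Longrightarrow> I k \<noteq> {}"
proof -
  have *: "\<forall>k\<ge>1. finite (I k) \<and> 2 \<le> card (I k)"
    using ifs unfolding nonautonomous_ifs_def by (elim conjE)
  then show "1 \<le> k \<Longrightarrow> finite (I k)" by blast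
  show "I k \<noteq> {}" if "1 \<le> k" using *[rule_format, OF that] by auto
qed

lemma J_props: "compact J" "interior J \<noteq> {}" "J \<noteq> {}"
proof -
  show "compact J" using ifs unfolding nonautonomous_ifs_def by (elim conjE)
  show *: "interior J \<noteq> {}" using ifs unfolding nonautonomous_ifs_def by (elim conjE)
  then show "J \<noteq> {}" by auto
qed

lemma finite_words_I: "1 \<le> l \<Longrightarrow> finite (words I l k)"
  using index_sets by (intro finite_words) auto

lemma word_map_J:
  assumes "1 \<le> l" "u \<in> words I l k" "x \<in> J"
  shows "word_map \<phi> l u x \<in> J"
  using assms
proof (induction u arbitrary: l)
  case (Cons i u)
  then have "1 \<le> l" "i \<in> I l" "word_map \<phi> (Suc l) u x \<in> J" by (auto simp: words_Cons)
  moreover have "\<forall>k\<ge>1. \<forall>i\<in>I k. \<phi> k i ` J \<subseteq> J"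
    using ifs unfolding nonautonomous_ifs_def by (elim conjE)
  ultimately show ?case by auto
qed simp

lemma word_map_contraction:
  assumes "1 \<le> l" "u \<in> words I l k" "x \<in> J" "y \<in> J"
  shows "norm (word_map \<phi> l u x - word_map \<phi> l u y) \<le> c ^ length u * norm (x - y)"
  using assms
proof (induction u arbitrary: l)
  case (Cons i u)
  let ?x = "word_map \<phi> (Suc l) u x" and ?y = "word_map \<phi> (Suc l) u y"
  have u: "i \<in> I l" "u \<in> words I (Suc l) k" using Cons.prems by (auto simp: words_Cons)
  have "norm (\<phi> l i ?x - \<phi> l i ?y) \<le> c * norm (?x - ?y)"
    using Cons.prems u by (intro contraction word_map_J[of "Suc l" u k]) auto
  also have "\<dots> \<le> c * (c ^ length u * norm (x - y))"
    using Cons u c by (intro mult_left_mono Cons.IH) auto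
  finally show ?case by (simp add: mult.assoc)
qed simp

lemma word_map_conformal:
  assumes "1 \<le> l" "u \<in> words I l k"
  shows "x \<in> V \<Longrightarrow> word_map \<phi> l u x \<in> V" "x \<in> V \<Longrightarrow> conformal_at (word_map \<phi> l u) x"
    "inj_on (word_map \<phi> l u) V"
proof -
  have "(\<forall>x\<in>V. word_map \<phi> l u x \<in> V \<and> conformal_at (word_map \<phi> l u) x) \<and> inj_on (word_map \<phi> l u) V"
    using assms
  proof (induction u arbitrary: l)
    case Nil
    have "word_map \<phi> l [] = id" by simp
    then show ?case using conformal_at_id inj_on_id by (metis id_apply)
  next
    case (Cons i u)
    then have "conformal_diffeo_into V (\<phi> l i)" by (auto simp: words_Cons intro: maps)
    then have i: "\<phi> l i ` V \<subseteq> V" "inj_on (\<phi> l i) V" "\<And>x. x \<in> V \<Longrightarrow> conformal_at (\<phi> l i) x"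
      by (auto simp: conformal_diffeo_into_def intro: conformal_diffeo_conformal_at)
    have u: "(\<forall>x\<in>V. word_map \<phi> (Suc l) u x \<in> V \<and> conformal_at (word_map \<phi> (Suc l) u) x) \<and>
      inj_on (word_map \<phi> (Suc l) u) V"
      using Cons by (auto simp: words_Cons)
    have "inj_on (\<phi> l i) (word_map \<phi> (Suc l) u ` V)"
      using i(2) u by (auto intro: inj_on_subset)
    then show ?case
      unfolding word_map.simps using i u by (intro conjI ballI conformal_at_compose comp_inj_on) auto
  qed
  then show "x \<in> V \<Longrightarrow> word_map \<phi> l u x \<in> V" "x \<in> V \<Longrightarrow> conformal_at (word_map \<phi> l u) x"
    "inj_on (word_map \<phi> l u) V" by auto
qed

lemma distortion:
  assumes "1 \<le> l" "u \<in> words I l k" "x \<in> V" "y \<in> V"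
  shows "deriv_scale (word_map \<phi> l u) x \<le> C * deriv_scale (word_map \<phi> l u) y"
proof (cases "l \<le> k")
  case False
  then have "u = []" using assms by (auto simp: words_def)
  then show ?thesis using C by (simp add: deriv_scale_id)
qed (use assms distortion_nonempty in auto)

lemma
  assumes "1 \<le> l" "u \<in> words I l k"
  shows deriv_scale_le_word_norm: "x \<in> J \<Longrightarrow> deriv_scale (word_map \<phi> l u) x \<le> word_norm l u"
    and word_norm_le_deriv_scale: "y \<in> V \<Longrightarrow> word_norm l u \<le> C * deriv_scale (word_map \<phi> l u) y"
    and word_norm_pos: "0 < word_norm l u"
proof -
  let ?f = "word_map \<phi> l u"
  obtain x0 where x0: "x0 \<in> J" using J_props by auto
  have "bdd_above (deriv_scale ?f ` J)"
    using distortion[OF assms, of _ x0] x0 V by (intro bdd_aboveI[of _ "C * deriv_scale ?f x0"]) auto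
  then show le: "deriv_scale ?f x \<le> word_norm l u" if "x \<in> J" for x
    unfolding word_norm_def deriv_norm_def using that by (rule cSUP_upper2) auto
  show "word_norm l u \<le> C * deriv_scale ?f y" if "y \<in> V"
    unfolding word_norm_def deriv_norm_def
    using J_props V that distortion[OF assms] by (intro cSUP_least) auto
  show "0 < word_norm l u"
    using conformal_atD(3)[OF word_map_conformal(2)[OF assms]] le[OF x0] x0 V by (auto intro: less_le_trans)
qed

text \<open>By the chain rule, scaling factors multiply along compositions. Bounded distortion allows to
  evaluate the factors at arbitrary points, so the norm of a word is comparable with the product of
  the norms of its two parts.\<close>

lemma word_norm_append:
  assumes "w \<in> words I 1 m" "v \<in> words I (Suc m) k"
  shows "word_norm 1 (w @ v) \<le> word_norm 1 w * word_norm (Suc m) v"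
    "word_norm 1 w * word_norm (Suc m) v \<le> C ^ 2 * word_norm 1 (w @ v)"
proof -
  have len: "length w = m" using assms by (simp add: words_def)
  have wv: "w @ v \<in> words I 1 (max m k)"
    using words_append[of m "max m k" w v I] assms by (auto simp: words_def max_def)
  let ?w = "word_map \<phi> 1 w" and ?v = "word_map \<phi> (Suc m) v"
  have eq: "word_map \<phi> 1 (w @ v) = ?w \<circ> ?v" using len by (simp add: word_map_append)
  have scale: "deriv_scale (?w \<circ> ?v) x = deriv_scale ?w (?v x) * deriv_scale ?v x" if "x \<in> V" for x
    using word_map_conformal[OF _ assms(1)] word_map_conformal[OF _ assms(2)] that
    by (intro deriv_scale_compose) auto
  have pos: "0 < deriv_scale ?w x" "0 < deriv_scale ?v x" if "x \<in> V" for x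
    using word_map_conformal[OF _ assms(1)] word_map_conformal[OF _ assms(2)] that
    by (auto intro!: conformal_atD(3))
  have vJ: "?v x \<in> J" if "x \<in> J" for x using word_map_J[OF _ assms(2) that] by simp
  show "word_norm 1 (w @ v) \<le> word_norm 1 w * word_norm (Suc m) v"
    unfolding word_norm_def[of 1 "w @ v"] deriv_norm_def eq
  proof (rule cSUP_least)
    fix x assume x: "x \<in> J"
    then have "x \<in> V" "?v x \<in> V" using vJ V by auto
    then show "deriv_scale (?w \<circ> ?v) x \<le> word_norm 1 w * word_norm (Suc m) v"
      using deriv_scale_le_word_norm[OF _ assms(1) vJ[OF x]] deriv_scale_le_word_norm[OF _ assms(2) x]
        pos(2)[of x] word_norm_pos[OF _ assms(1)]
      unfolding scale[OF \<open>x \<in> V\<close>] by (intro mult_mono) (auto intro: less_imp_le)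
  qed (use J_props in auto)
  obtain x where x: "x \<in> J" using J_props by auto
  then have xV: "x \<in> V" "?v x \<in> V" using vJ V by auto
  have "word_norm 1 w * word_norm (Suc m) v \<le> (C * deriv_scale ?w (?v x)) * (C * deriv_scale ?v x)"
    using word_norm_le_deriv_scale[OF _ assms(1) xV(2)] word_norm_le_deriv_scale[OF _ assms(2) xV(1)]
      word_norm_pos[OF _ assms(2)] pos xV C
    by (intro mult_mono) (auto intro: less_imp_le)
  also have "\<dots> = C ^ 2 * deriv_scale (?w \<circ> ?v) x" unfolding scale[OF xV(1)] by (simp add: power2_eq_square)
  also have "\<dots> \<le> C ^ 2 * word_norm 1 (w @ v)"
    using deriv_scale_le_word_norm[OF _ wv x] eq by (intro mult_left_mono) auto
  finally show "word_norm 1 w * word_norm (Suc m) v \<le> C ^ 2 * word_norm 1 (w @ v)" .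
qed

text \<open>It suffices to estimate the derivative at one interior point of \<open>J\<close>, where it is controlled by
  the Lipschitz constant; distortion does the rest.\<close>

lemma word_norm_le_power:
  assumes "u \<in> words I 1 k"
  shows "word_norm 1 u \<le> C * c ^ k"
proof -
  obtain x where x: "x \<in> interior J" using J_props by auto
  then have xJ: "x \<in> J" "x \<in> V" using interior_subset V by auto
  have "word_norm 1 u \<le> C * deriv_scale (word_map \<phi> 1 u) x"
    using word_norm_le_deriv_scale[OF _ assms xJ(2)] by simp
  also have "deriv_scale (word_map \<phi> 1 u) x \<le> c ^ length u"
    using x xJ assms by (intro deriv_scale_le_of_lipschitz word_map_conformal word_map_contraction) auto
  also have "length u = k" using assms by (simp add: words_def)
  finally show ?thesis using C by (simp add: mult_left_mono)
qed

lemma Jw_eq: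
  assumes "u \<in> words I 1 k"
  obtains \<omega> where "Jw u = (\<lambda>x. word_map \<phi> 1 u x + \<omega>) ` J"
proof -
  have "\<forall>k. \<forall>u\<in>words I 1 k. \<exists>\<omega>. Jw u = (\<lambda>x. word_map \<phi> 1 u x + \<omega>) ` J"
    using ifs unfolding nonautonomous_ifs_def by (elim conjE)
  then show ?thesis using assms that by blast
qed

lemma Jw_closed_subset: "u \<in> words I 1 k \<Longrightarrow> closed (Jw u) \<and> Jw u \<subseteq> J"
proof -
  have "\<forall>k. \<forall>u\<in>words I 1 k. closed (Jw u) \<and> Jw u \<subseteq> J"
    using ifs unfolding nonautonomous_ifs_def by (elim conjE)
  then show "u \<in> words I 1 k \<Longrightarrow> closed (Jw u) \<and> Jw u \<subseteq> J" by blast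
qed

lemma Jw_nonempty:
  assumes "u \<in> words I 1 k"
  shows "Jw u \<noteq> {}"
proof -
  obtain \<omega> where "Jw u = (\<lambda>x. word_map \<phi> 1 u x + \<omega>) ` J" by (rule Jw_eq[OF assms])
  then show ?thesis using J_props(3) by simp
qed

lemma words_Suc:
  "u \<in> words I 1 (Suc k) \<longleftrightarrow> (\<exists>u' i. u = u' @ [i] \<and> u' \<in> words I 1 k \<and> i \<in> I (Suc k))"
proof (cases u rule: rev_cases)
  case (snoc u' i)
  then show ?thesis using words_append[of k "Suc k" u' "[i]" I] by (auto simp: words_def)
qed (auto simp: words_def)

lemma Jw_mono_step:
  assumes "u \<in> words I 1 k" "i \<in> I (Suc k)"
  shows "Jw (u @ [i]) \<subseteq> Jw u"
proof -
  have "\<forall>k\<ge>1. \<forall>u\<in>words I 1 (k - 1). \<forall>i\<in>I k. Jw (u @ [i]) \<subseteq> Jw u"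
    using ifs unfolding nonautonomous_ifs_def by (elim conjE)
  from this[rule_format, of "Suc k" u i] show ?thesis using assms by simp
qed

lemma Jw_subset_take:
  assumes "u \<in> words I 1 k" "m \<le> k"
  shows "Jw u \<subseteq> Jw (take m u)"
  using assms
proof (induction k arbitrary: u)
  case 0
  then show ?case by (simp add: words_def)
next
  case (Suc k)
  then obtain u' i where u: "u = u' @ [i]" "u' \<in> words I 1 k" "i \<in> I (Suc k)"
    using words_Suc by blast
  show ?case
  proof (cases "m = Suc k")
    case True
    then show ?thesis using Suc.prems by (simp add: words_def)
  next
    case False
    then have "Jw u' \<subseteq> Jw (take m u')" using Suc u by auto
    moreover have "take m u = take m u'" using u False Suc.prems by (simp add: words_def)
    ultimately show ?thesis using Jw_mono_step[OF u(2,3)] u(1) by auto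
  qed
qed

text \<open>The open set condition separates siblings only. Two words of the same length pass through a pair of
  siblings where they first differ, and the cylinders are nested.\<close>

lemma interiors_disjoint:
  assumes "u \<in> words I 1 k" "v \<in> words I 1 k" "u \<noteq> v"
  shows "interior (Jw u) \<inter> interior (Jw v) = {}"
  using assms
proof (induction k arbitrary: u v)
  case 0
  then show ?case by (simp add: words_def)
next
  case (Suc k)
  obtain u' i where u: "u = u' @ [i]" "u' \<in> words I 1 k" "i \<in> I (Suc k)"
    using Suc.prems(1) words_Suc by blast
  obtain v' j where v: "v = v' @ [j]" "v' \<in> words I 1 k" "j \<in> I (Suc k)"
    using Suc.prems(2) words_Suc by blast
  show ?case
  proof (cases "u' = v'")
    case True
    then show ?thesis
      using osc u v Suc.prems(3) unfolding open_set_condition_def by auto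
  next
    case False
    then have "interior (Jw u') \<inter> interior (Jw v') = {}" using Suc.IH u v by blast
    then show ?thesis
      using interior_mono[OF Jw_mono_step[OF u(2,3)]] interior_mono[OF Jw_mono_step[OF v(2,3)]] u v
      by blast
  qed
qed

text \<open>By bounded distortion, \<open>C * word_norm 1 u\<close> bounds the derivative on all of \<open>V\<close>, and the constant in
  \<open>displacement_le_of_derivative_bound\<close> does not depend on the map. The translation that places the
  cylinder does not change distances.\<close>

lemma cylinder_diameter:
  obtains K where "K > 0"
    "\<And>k u x y. u \<in> words I 1 k \<Longrightarrow> x \<in> Jw u \<Longrightarrow> y \<in> Jw u \<Longrightarrow> dist x y \<le> K * word_norm 1 u"
proof -
  obtain K where K: "K > 0"
    "\<And>(f :: 'a \<Rightarrow> 'a) f' M x y. (\<And>x. x \<in> V \<Longrightarrow> (f has_derivative f' x) (at x)) \<Longrightarrow>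
       (\<And>x. x \<in> V \<Longrightarrow> onorm (f' x) \<le> M) \<Longrightarrow> x \<in> J \<Longrightarrow> y \<in> J \<Longrightarrow> dist (f x) (f y) \<le> K * M"
    using displacement_le_of_derivative_bound[OF V(1,2) J_props(1) V(3)] by blast
  show ?thesis
  proof (rule that[of "K * C"])
    fix k u x y assume u: "u \<in> words I 1 k" and xy: "x \<in> Jw u" "y \<in> Jw u"
    let ?f = "word_map \<phi> 1 u"
    have conf: "conformal_at ?f z" if "z \<in> V" for z
      using word_map_conformal(2)[OF _ u that] by simp
    obtain \<omega> where \<omega>: "Jw u = (\<lambda>x. ?f x + \<omega>) ` J" by (rule Jw_eq[OF u])
    then obtain x' y' where xy': "x' \<in> J" "y' \<in> J" "x = ?f x' + \<omega>" "y = ?f y' + \<omega>"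
      using xy by auto
    have "dist (?f x') (?f y') \<le> K * (C * word_norm 1 u)"
    proof (rule K(2)[OF _ _ xy'(1,2)])
      fix z assume z: "z \<in> V"
      show "(?f has_derivative frechet_derivative ?f (at z)) (at z)"
        by (rule conformal_atD(1)[OF conf[OF z]])
      have "onorm (frechet_derivative ?f (at z)) \<le> deriv_scale ?f z"
        by (rule conformal_atD(4)[OF conf[OF z]])
      also have "\<dots> \<le> C * deriv_scale ?f x'"
        using distortion[OF _ u z] xy' V by auto
      also have "\<dots> \<le> C * word_norm 1 u"
        using deriv_scale_le_word_norm[OF _ u xy'(1)] C by (intro mult_left_mono) auto
      finally show "onorm (frechet_derivative ?f (at z)) \<le> C * word_norm 1 u" .
    qed
    then show "dist x y \<le> K * C * word_norm 1 u" using xy' by (simp add: mult.assoc)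
  qed (use K C in auto)
qed

text \<open>The image of one fixed ball inside \<open>J\<close> serves for all words: on it the map of \<open>u\<close> stretches by at least
  \<open>word_norm 1 u / C\<close>.\<close>

lemma cylinder_inner_ball:
  obtains \<kappa> where "\<kappa> > 0"
    "\<And>k u. u \<in> words I 1 k \<Longrightarrow> \<exists>z\<in>Jw u. ball z (\<kappa> * word_norm 1 u) \<subseteq> interior (Jw u)"
proof -
  obtain x r where r: "0 < r" "ball x r \<subseteq> J"
    using J_props(2) mem_interior by blast
  have rV: "ball x r \<subseteq> V" "x \<in> J" using r V centre_in_ball[of x r] by auto
  show ?thesis
  proof (rule that[of "r / C"])
    fix k u assume u: "u \<in> words I 1 k"
    let ?f = "word_map \<phi> 1 u" and ?\<mu> = "word_norm 1 u / C"
    have conf: "conformal_at ?f z" if "z \<in> ball x r" for z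
      using word_map_conformal(2)[OF _ u] rV that by auto
    obtain \<omega> where \<omega>: "Jw u = (\<lambda>x. ?f x + \<omega>) ` J" by (rule Jw_eq[OF u])
    have "ball (?f x) (?\<mu> * r) \<subseteq> ?f ` ball x r"
    proof (rule ball_subset_image_of_expanding_derivative)
      show "0 < ?\<mu>" using word_norm_pos[OF _ u] C by simp
      show "inj_on ?f (ball x r)"
        using word_map_conformal(3)[OF _ u] rV by (auto intro: inj_on_subset)
      fix z assume z: "z \<in> ball x r"
      show "(?f has_derivative frechet_derivative ?f (at z)) (at z)"
        by (rule conformal_atD(1)[OF conf[OF z]])
      fix v
      have "?\<mu> \<le> deriv_scale ?f z"
        using word_norm_le_deriv_scale[OF _ u, of z] z rV C by (auto simp: field_simps)
      then show "?\<mu> * norm v \<le> norm (frechet_derivative ?f (at z) v)"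
        unfolding conformal_atD(2)[OF conf[OF z]] by (intro mult_right_mono) auto
    qed (rule r)
    then have "(\<lambda>y. \<omega> + y) ` ball (?f x) (?\<mu> * r) \<subseteq> (\<lambda>y. \<omega> + y) ` ?f ` J"
      using r(2) by (intro image_mono) (meson image_mono subset_trans)
    moreover have eq: "Jw u = (\<lambda>y. \<omega> + y) ` ?f ` J"
      unfolding \<omega> by (simp add: image_image add.commute[of _ \<omega>])
    ultimately have sub: "(\<lambda>y. \<omega> + y) ` ball (?f x) (?\<mu> * r) \<subseteq> Jw u" by simp
    have "ball (\<omega> + ?f x) (r / C * word_norm 1 u) \<subseteq> interior (Jw u)"
    proof (rule interior_maximal)
      have "?\<mu> * r = r / C * word_norm 1 u" by simp
      then show "ball (\<omega> + ?f x) (r / C * word_norm 1 u) \<subseteq> Jw u"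
        using sub by (metis ball_translation)
    qed simp
    moreover have "\<omega> + ?f x \<in> Jw u" unfolding eq using rV(2) by (intro imageI)
    ultimately show "\<exists>z\<in>Jw u. ball z (r / C * word_norm 1 u) \<subseteq> interior (Jw u)" by blast
  qed (use r C in auto)
qed

text \<open>Any infinite continuation of the word \<open>w\<close> gives a decreasing sequence of non-empty compact cylinders.\<close>

lemma attractor_meets_cylinder:
  assumes "w \<in> words I 1 m"
  shows "E \<inter> Jw w \<noteq> {}"
proof -
  define a where "a j = (if j < m then w ! j else SOME i. i \<in> I (Suc j))" for j
  define u where "u n = map a [0..<n]" for n
  have aI: "a j \<in> I (Suc j)" for j
    using assms some_in_eq index_sets(2)[of "Suc j"] unfolding a_def by (auto simp: words_def)
  have u: "u n \<in> words I 1 n" for n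
    using aI by (auto simp: u_def words_def)
  have "take m (u n) = u m" if "m \<le> n" for m n
    using that by (simp add: u_def take_map)
  then have dec: "Jw (u n) \<subseteq> Jw (u m)" if "m \<le> n" for m n
    using Jw_subset_take[OF u that] that by simp
  have "(\<Inter>n. Jw (u n)) \<noteq> {}"
  proof (rule compact_nest)
    fix n
    show "compact (Jw (u n))"
      using Jw_closed_subset[OF u[of n]] compact_Int_closed[OF J_props(1)] by (metis inf.absorb2)
    show "Jw (u n) \<noteq> {}" by (rule Jw_nonempty[OF u])
  qed (rule dec)
  then obtain x where x: "\<And>n. x \<in> Jw (u n)" by auto
  have "u m = w" using assms by (auto simp: u_def a_def words_def intro: nth_equalityI)
  then have "x \<in> Jw w" using x by metis
  moreover have "x \<in> E" unfolding attractor_def using x u by blast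
  ultimately show ?thesis by blast
qed

lemma attractor_nonempty: "E \<noteq> {}"
  using attractor_meets_cylinder[of "[]" 0] by (auto simp: words_def)

lemma attractor_subset: "E \<subseteq> J"
proof
  fix x assume "x \<in> E"
  then obtain u where "u \<in> words I 1 1" "x \<in> Jw u" unfolding attractor_def by force
  then show "x \<in> J" using Jw_closed_subset by blast
qed

lemma attractor_closed: "closed E"
  unfolding attractor_def
  using Jw_closed_subset finite_words_I by (intro closed_INT ballI closed_UN) auto

lemma open_contains_cylinder:
  assumes "open U" "x \<in> E" "x \<in> U"
  obtains m w where "w \<in> words I 1 m" "Jw w \<subseteq> U"
proof -
  obtain e where e: "e > 0" "ball x e \<subseteq> U" using assms open_contains_ball by blast
  have bJ: "bounded J" using J_props(1) compact_imp_bounded by blast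
  have "(\<lambda>m. c ^ m) \<longlonglongrightarrow> 0"
    by (rule LIMSEQ_realpow_zero) (use c in auto)
  then have "(\<lambda>m. c ^ m * diameter J) \<longlonglongrightarrow> 0"
    by (rule tendsto_mult_left_zero)
  then have "\<forall>\<^sub>F m in sequentially. c ^ m * diameter J < e"
    using e(1) by (rule order_tendstoD)
  with eventually_ge_at_top[of 1] have "\<forall>\<^sub>F m in sequentially. 1 \<le> m \<and> c ^ m * diameter J < e"
    by eventually_elim simp
  then obtain m where m: "1 \<le> m" "c ^ m * diameter J < e"
    unfolding eventually_sequentially by blast
  obtain w where w: "w \<in> words I 1 m" "x \<in> Jw w"
    using assms(2) m(1) unfolding attractor_def by auto
  obtain \<omega> where \<omega>: "Jw w = (\<lambda>x. word_map \<phi> 1 w x + \<omega>) ` J" by (rule Jw_eq[OF w(1)])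
  have "Jw w \<subseteq> ball x e"
  proof
    fix y assume "y \<in> Jw w"
    then obtain x' y' where xy': "x' \<in> J" "y' \<in> J" "x = word_map \<phi> 1 w x' + \<omega>" "y = word_map \<phi> 1 w y' + \<omega>"
      using w(2) unfolding \<omega> by auto
    have "dist x y = norm (word_map \<phi> 1 w x' - word_map \<phi> 1 w y')"
      using xy' by (simp add: dist_norm)
    also have "\<dots> \<le> c ^ length w * norm (x' - y')"
      using word_map_contraction[OF _ w(1) xy'(1,2)] by simp
    also have "\<dots> \<le> c ^ m * diameter J"
      using diameter_bounded_bound[OF bJ xy'(1,2)] w(1) c
      by (intro mult_mono) (auto simp: words_def dist_norm)
    finally show "y \<in> ball x e" using m(2) by simp
  qed
  then show ?thesis using that w e by blast
qed

end


section \<open>Packings from families of cylinders\<close>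

lemma separated_net:
  fixes y :: "'b \<Rightarrow> 'a::metric_space"
  assumes "finite G" "0 \<le> r"
  obtains H where "H \<subseteq> G" "\<And>g h. g \<in> H \<Longrightarrow> h \<in> H \<Longrightarrow> g \<noteq> h \<Longrightarrow> r < dist (y g) (y h)"
    "\<And>g. g \<in> G \<Longrightarrow> \<exists>h\<in>H. dist (y g) (y h) \<le> r"
proof -
  have "\<exists>H\<subseteq>G. (\<forall>g\<in>H. \<forall>h\<in>H. g \<noteq> h \<longrightarrow> r < dist (y g) (y h)) \<and> (\<forall>g\<in>G. \<exists>h\<in>H. dist (y g) (y h) \<le> r)"
    using assms(1)
  proof (induction G rule: finite_induct)
    case (insert g G)
    then obtain H where H: "H \<subseteq> G" "\<forall>g\<in>H. \<forall>h\<in>H. g \<noteq> h \<longrightarrow> r < dist (y g) (y h)"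
      "\<forall>g\<in>G. \<exists>h\<in>H. dist (y g) (y h) \<le> r" by blast
    show ?case
    proof (cases "\<exists>h\<in>H. dist (y g) (y h) \<le> r")
      case True
      then show ?thesis using H by (intro exI[of _ H]) auto
    next
      case False
      then have far: "r < dist (y g) (y h)" "r < dist (y h) (y g)" if "h \<in> H" for h
        using that by (auto simp: not_le dist_commute)
      show ?thesis
      proof (intro exI[of _ "insert g H"] conjI)
        show "\<forall>x\<in>insert g H. \<forall>h\<in>insert g H. x \<noteq> h \<longrightarrow> r < dist (y x) (y h)"
          using H(2) far by blast
        have "dist (y g) (y g) \<le> r" using assms(2) by simp
        then show "\<forall>x\<in>insert g G. \<exists>h\<in>insert g H. dist (y x) (y h) \<le> r" using H(3) by blast
      qed (use H in auto)
    qed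
  qed auto
  then obtain H where H: "H \<subseteq> G" "\<forall>g\<in>H. \<forall>h\<in>H. g \<noteq> h \<longrightarrow> r < dist (y g) (y h)"
    "\<forall>g\<in>G. \<exists>h\<in>H. dist (y g) (y h) \<le> r" by blast
  show ?thesis
    by (rule that[OF H(1)]) (use H in auto)
qed

lemma card_le_mult_of_cover:
  assumes "finite H" "G \<subseteq> (\<Union>h\<in>H. T h)" "\<And>h. h \<in> H \<Longrightarrow> finite (T h) \<and> card (T h) \<le> N"
  shows "card G \<le> card H * N"
proof -
  have "card G \<le> card (\<Union>h\<in>H. T h)" using assms by (intro card_mono) auto
  also have "\<dots> \<le> (\<Sum>h\<in>H. card (T h))" by (rule card_UN_le[OF assms(1)])
  also have "\<dots> \<le> card H * N" using assms(3) sum_bounded_above[of H "\<lambda>h. card (T h)" N] by simp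
  finally show ?thesis .
qed

lemma packing_premeasure_at_ge_card:
  fixes A :: "'a::euclidean_space set"
  assumes "finite H" "y ` H \<subseteq> A" "0 < d" "d \<le> \<delta>" "0 \<le> s"
    and sep: "\<And>g h. g \<in> H \<Longrightarrow> h \<in> H \<Longrightarrow> g \<noteq> h \<Longrightarrow> 2 * d < dist (y g) (y h)"
  shows "ennreal (real (card H) * d powr s) \<le> packing_premeasure_at s \<delta> A"
proof -
  define B where "B = (\<lambda>h. (y h, d)) ` H"
  have inj: "inj_on (\<lambda>h. (y h, d)) H"
  proof (rule inj_onI, rule ccontr)
    fix g h assume "g \<in> H" "h \<in> H" "(y g, d) = (y h, d)" "g \<noteq> h"
    then show False using sep[of g h] assms(3) by auto
  qed
  have "B \<in> packings \<delta> A"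
    unfolding packings_def
  proof (intro CollectI conjI)
    show "countable B" unfolding B_def using assms(1) by (auto intro: countable_finite)
    show "\<forall>(x, r)\<in>B. x \<in> A \<and> 0 < r \<and> r \<le> \<delta>" unfolding B_def using assms by auto
    have "cball (y g) d \<inter> cball (y h) d = {}" if "g \<in> H" "h \<in> H" "(y g, d) \<noteq> (y h, d)" for g h
    proof -
      have "2 * d < dist (y g) (y h)" using sep that by blast
      then have "z \<notin> cball (y g) d \<inter> cball (y h) d" for z
        using dist_triangle2[of "y g" "y h" z] by auto
      then show ?thesis by blast
    qed
    then show "disjoint_family_on (\<lambda>(x, r). cball x r) B"
      unfolding disjoint_family_on_def B_def by auto
  qed
  then have "(\<Sum>\<^sub>\<infinity>(x, r)\<in>B. ennreal ((2 * r) powr s)) \<le> packing_premeasure_at s \<delta> A"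
    unfolding packing_premeasure_at_def by (rule SUP_upper)
  moreover have "(\<Sum>\<^sub>\<infinity>(x, r)\<in>B. ennreal ((2 * r) powr s)) = ennreal (real (card H) * (2 * d) powr s)"
  proof -
    have "finite B" unfolding B_def using assms(1) by simp
    then have "(\<Sum>\<^sub>\<infinity>(x, r)\<in>B. ennreal ((2 * r) powr s)) = (\<Sum>(x, r)\<in>B. ennreal ((2 * r) powr s))"
      by (rule infsum_finite)
    also have "\<dots> = (\<Sum>h\<in>H. ennreal ((2 * d) powr s))"
      unfolding B_def by (subst sum.reindex[OF inj]) (simp add: o_def)
    also have "\<dots> = ennreal (\<Sum>h\<in>H. (2 * d) powr s)" by (rule sum_ennreal) simp
    finally show ?thesis by simp
  qed
  moreover have "real (card H) * d powr s \<le> real (card H) * (2 * d) powr s"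
    using assms(3,5) by (intro mult_left_mono powr_mono2) auto
  ultimately show ?thesis by (metis ennreal_leI order_trans)
qed

context conformal_ifs
begin

section \<open>Growth of the pressure sums\<close>

text \<open>At an exponent slightly above \<open>s\<close> the pressure is non-negative, so the sums decay at most
  subexponentially along a subsequence. Lowering the exponent to \<open>s\<close> gains an exponential factor,
  because all norms at level \<open>k\<close> are at most \<open>C * c ^ k\<close>.\<close>

lemma word_norm_sums_unbounded:
  assumes "0 \<le> s" "ereal s < critical_exponent I J \<phi>"
  shows "\<exists>k\<ge>k0. B < (\<Sum>u\<in>words I 1 k. word_norm 1 u powr s)"
proof -
  obtain t where t: "s < t" "ereal t < critical_exponent I J \<phi>"
    using ereal_dense2[OF assms(2)] by auto
  have pressure: "0 \<le> upper_pressure I J \<phi> t"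
  proof (rule ccontr)
    assume "\<not> 0 \<le> upper_pressure I J \<phi> t"
    then have "critical_exponent I J \<phi> \<le> ereal t"
      unfolding critical_exponent_def by (intro Inf_lower) (auto simp: not_le)
    then show False using t(2) by simp
  qed
  define S where "S k t = (\<Sum>u\<in>words I 1 k. word_norm 1 u powr t)" for k t
  have nonempty: "words I 1 k \<noteq> {}" for k
  proof -
    have "(SOME i. i \<in> I (Suc j)) \<in> I (Suc j)" for j
      using index_sets(2)[of "Suc j"] some_in_eq by auto
    then have "map (\<lambda>j. SOME i. i \<in> I (Suc j)) [0..<k] \<in> words I 1 k"
      by (auto simp: words_def)
    then show ?thesis by blast
  qed
  have S_pos: "0 < S k t" for k t
    unfolding S_def
  proof (rule sum_pos)
    fix u assume "u \<in> words I 1 k"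
    then have "0 < word_norm 1 u" using word_norm_pos[of 1 u k] by simp
    then show "0 < word_norm 1 u powr t" by simp
  qed (use nonempty finite_words_I in auto)
  \<comment> \<open>Half of the exponential gain from lowering the exponent from \<open>t\<close> to \<open>s\<close> pays for the
    possible decay of the sums with exponent \<open>t\<close>; the other half makes the sums blow up.\<close>
  define \<epsilon> where "\<epsilon> = - (t - s) * ln c / 2"
  have \<epsilon>: "0 < \<epsilon>" using t(1) c mult_pos_neg[of "t - s" "ln c"] by (simp add: \<epsilon>_def algebra_simps)
  have freq: "\<exists>k\<ge>k1. exp (- \<epsilon> * real k) < S k t" for k1
  proof (rule ccontr)
    assume "\<not> (\<exists>k\<ge>k1. exp (- \<epsilon> * real k) < S k t)"
    then have le: "S k t \<le> exp (- \<epsilon> * real k)" if "k \<ge> k1" for k using that by (auto simp: not_less)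
    have "upper_pressure I J \<phi> t \<le> ereal (- \<epsilon>)"
      unfolding upper_pressure_def
    proof (rule Limsup_bounded)
      have "1 / real k * ln (\<Sum>u\<in>words I 1 k. deriv_norm J (word_map \<phi> 1 u) powr t) \<le> - \<epsilon>"
        if "k \<ge> max k1 1" for k
      proof -
        have "ln (S k t) \<le> - \<epsilon> * real k"
          using le[of k] S_pos[of k t] that by (metis ln_exp ln_mono max.bounded_iff)
        then have "1 / real k * ln (S k t) \<le> - \<epsilon>"
          using that by (simp add: divide_simps mult.commute)
        then show ?thesis by (simp add: S_def word_norm_def)
      qed
      then show "\<forall>\<^sub>F k in sequentially. ereal (1 / real k *
          ln (\<Sum>u\<in>words I 1 k. deriv_norm J (word_map \<phi> 1 u) powr t)) \<le> ereal (- \<epsilon>)"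
        unfolding eventually_sequentially ereal_less_eq by blast
    qed
    then show False using pressure \<epsilon> by (metis ereal_less_eq(3) leD neg_less_0_iff_less order_trans zero_ereal_def)
  qed
  define D where "D = C powr (t - s)"
  have D: "0 < D" using C by (simp add: D_def)
  have compare: "exp (2 * \<epsilon> * real k) * S k t \<le> D * S k s" for k
  proof -
    have "S k t \<le> (\<Sum>u\<in>words I 1 k. D * exp (- 2 * \<epsilon> * real k) * word_norm 1 u powr s)"
      unfolding S_def
    proof (rule sum_mono)
      fix u assume u: "u \<in> words I 1 k"
      have "word_norm 1 u powr t = word_norm 1 u powr (t - s) * word_norm 1 u powr s"
        by (simp flip: powr_add)
      also have "word_norm 1 u powr (t - s) \<le> (C * c ^ k) powr (t - s)"
        using word_norm_le_power[OF u] word_norm_pos[OF _ u] t(1) by (intro powr_mono2) auto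
      also have "(C * c ^ k) powr (t - s) = D * (c ^ k) powr (t - s)"
        using C c by (simp add: powr_mult D_def)
      also have "(c ^ k) powr (t - s) = exp (- 2 * \<epsilon> * real k)"
        using c by (simp add: powr_def ln_realpow \<epsilon>_def algebra_simps)
      finally show "word_norm 1 u powr t \<le> D * exp (- 2 * \<epsilon> * real k) * word_norm 1 u powr s"
        by (simp add: mult_right_mono)
    qed
    also have "\<dots> = exp (- 2 * \<epsilon> * real k) * (D * S k s)"
      by (simp add: S_def sum_distrib_left mult_ac)
    finally have "exp (2 * \<epsilon> * real k) * S k t
        \<le> exp (2 * \<epsilon> * real k) * (exp (- 2 * \<epsilon> * real k) * (D * S k s))"
      by (intro mult_left_mono) auto
    also have "\<dots> = D * S k s"
      by (simp add: mult.assoc[symmetric] flip: exp_add)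
    finally show ?thesis .
  qed
  obtain k1 :: nat where k1: "\<bar>B\<bar> * D < real k1 * \<epsilon>"
    using reals_Archimedean3[OF \<epsilon>] by blast
  obtain k where k: "k \<ge> max k0 k1" "exp (- \<epsilon> * real k) < S k t" using freq by blast
  have "B * D \<le> \<bar>B\<bar> * D" using D by (intro mult_right_mono) auto
  also have "\<dots> < \<epsilon> * real k" using k1 k(1) \<epsilon> by (smt (verit) max.bounded_iff mult.commute mult_left_mono of_nat_le_iff)
  also have "\<dots> < exp (\<epsilon> * real k)" using exp_ge_add_one_self[of "\<epsilon> * real k"] by linarith
  also have "\<dots> = exp (2 * \<epsilon> * real k) * exp (- \<epsilon> * real k)" by (simp flip: exp_add add: algebra_simps)
  also have "\<dots> < exp (2 * \<epsilon> * real k) * S k t" using k(2) by simp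
  also have "\<dots> \<le> D * S k s" by (rule compare)
  finally have "B < S k s" using D by (simp add: mult.commute)
  then show ?thesis using k(1) by (auto simp: S_def)
qed

text \<open>Localisation to one cylinder: there are finitely many words of length \<open>m\<close>, and by bounded distortion
  the sums over the continuations of any two of them are comparable, uniformly in \<open>k\<close>. Therefore the
  growth of the full sum is shared by every cylinder of level \<open>m\<close>.\<close>

lemma word_norm_sums_below_word_unbounded:
  assumes "0 \<le> s" "ereal s < critical_exponent I J \<phi>" "w \<in> words I 1 m"
  shows "\<exists>k\<ge>k0. m \<le> k \<and> B < (\<Sum>v\<in>words I (Suc m) k. word_norm 1 (w @ v) powr s)"
proof -
  define W where "W = (\<Sum>w'\<in>words I 1 m. word_norm 1 w' powr s)"
  define a where "a = word_norm 1 w powr s / (C ^ 2) powr s"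
  have w0: "0 < word_norm 1 w" using word_norm_pos[OF _ assms(3)] by simp
  have C2: "0 < C ^ 2" using C by simp
  have a: "0 < a" using w0 C2 by (simp add: a_def)
  have W: "0 < W"
    unfolding W_def using assms(3) finite_words_I[of 1 m] w0
    by (intro sum_pos2[of _ w]) auto
  obtain k where k: "k \<ge> max k0 m" "B * W / a < (\<Sum>u\<in>words I 1 k. word_norm 1 u powr s)"
    using word_norm_sums_unbounded[OF assms(1,2)] by blast
  define T where "T = (\<Sum>v\<in>words I (Suc m) k. word_norm (Suc m) v powr s)"
  have mk: "m \<le> k" using k by simp
  have "(\<Sum>u\<in>words I 1 k. word_norm 1 u powr s)
      \<le> (\<Sum>(w', v)\<in>words I 1 m \<times> words I (Suc m) k. word_norm 1 (w' @ v) powr s)"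
  proof -
    have "words I 1 k \<subseteq> (\<lambda>(w', v). w' @ v) ` (words I 1 m \<times> words I (Suc m) k)"
    proof
      fix u assume u: "u \<in> words I 1 k"
      have "u = (\<lambda>(w', v). w' @ v) (take m u, drop m u)" by simp
      then show "u \<in> (\<lambda>(w', v). w' @ v) ` (words I 1 m \<times> words I (Suc m) k)"
        using words_take_drop[OF u mk] by blast
    qed
    then have "(\<Sum>u\<in>words I 1 k. word_norm 1 u powr s)
      \<le> (\<Sum>u\<in>(\<lambda>(w', v). w' @ v) ` (words I 1 m \<times> words I (Suc m) k). word_norm 1 u powr s)"
      using finite_words_I[of 1 m] finite_words_I[of "Suc m" k] by (intro sum_mono2) auto
    also have "\<dots> \<le> (\<Sum>x\<in>words I 1 m \<times> words I (Suc m) k. word_norm 1 (case x of (w', v) \<Rightarrow> w' @ v) powr s)"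
      using finite_words_I[of 1 m] finite_words_I[of "Suc m" k]
      by (intro sum_image_le[unfolded o_def]) auto
    finally show ?thesis by (simp add: case_prod_unfold)
  qed
  also have "\<dots> \<le> (\<Sum>(w', v)\<in>words I 1 m \<times> words I (Suc m) k. word_norm 1 w' powr s * word_norm (Suc m) v powr s)"
  proof (rule sum_mono, clarify)
    fix w' v assume wv: "w' \<in> words I 1 m" "v \<in> words I (Suc m) k"
    have "w' @ v \<in> words I 1 k" using words_append[OF mk, of w' v I] wv by blast
    then have "word_norm 1 (w' @ v) powr s \<le> (word_norm 1 w' * word_norm (Suc m) v) powr s"
      using word_norm_append(1)[OF wv] word_norm_pos[of 1 "w' @ v" k] assms(1) by (intro powr_mono2) auto
    also have "\<dots> = word_norm 1 w' powr s * word_norm (Suc m) v powr s"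
      by (simp add: powr_mult)
    finally show "word_norm 1 (w' @ v) powr s \<le> word_norm 1 w' powr s * word_norm (Suc m) v powr s" .
  qed
  also have "\<dots> = W * T"
    unfolding W_def T_def by (simp add: sum_product sum.cartesian_product)
  finally have "B * W / a < W * T" using k(2) by simp
  then have "B * W < (a * T) * W" using a by (simp add: pos_divide_less_eq mult_ac)
  then have "B < a * T" using W by simp
  also have "a * T \<le> (\<Sum>v\<in>words I (Suc m) k. word_norm 1 (w @ v) powr s)"
    unfolding T_def sum_distrib_left
  proof (rule sum_mono)
    fix v assume v: "v \<in> words I (Suc m) k"
    have wv: "w @ v \<in> words I 1 k" using words_append[OF mk, of w v I] v assms(3) by blast
    have "word_norm 1 w powr s * word_norm (Suc m) v powr s = (word_norm 1 w * word_norm (Suc m) v) powr s"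
      by (simp add: powr_mult)
    also have "\<dots> \<le> (C ^ 2 * word_norm 1 (w @ v)) powr s"
      using word_norm_append(2)[OF assms(3) v] w0 word_norm_pos[OF _ v] assms(1)
      by (intro powr_mono2) (auto intro!: mult_nonneg_nonneg less_imp_le)
    also have "\<dots> = (C ^ 2) powr s * word_norm 1 (w @ v) powr s"
      by (simp add: powr_mult)
    finally show "a * word_norm (Suc m) v powr s \<le> word_norm 1 (w @ v) powr s"
      unfolding a_def using C2 by (simp add: divide_simps mult_ac)
  qed
  finally show ?thesis using k(1) by auto
qed

section \<open>Packing premeasure of a set accumulating at a piece of the attractor\<close>

text \<open>Cylinders with norm about \<open>d\<close> that come within distance of order \<open>d\<close> of a point \<open>p\<close> lie in a ball of
  radius of order \<open>d\<close> about \<open>p\<close>, and they contain disjoint balls with radius of order \<open>d\<close>. The points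
  \<open>y u\<close> are only required to lie near the cylinders because they will be taken from a set that has
  a piece of the attractor only in its closure.\<close>

lemma cylinder_overlap_bound:
  obtains N :: nat where
    "\<And>k d G (y :: 'i list \<Rightarrow> 'a) p. 0 < d \<Longrightarrow> finite G \<Longrightarrow> G \<subseteq> words I 1 k \<Longrightarrow>
       (\<And>u. u \<in> G \<Longrightarrow> d / 2 < word_norm 1 u \<and> word_norm 1 u \<le> d) \<Longrightarrow>
       (\<And>u. u \<in> G \<Longrightarrow> \<exists>x\<in>Jw u. dist x (y u) \<le> d) \<Longrightarrow>
       (\<And>u. u \<in> G \<Longrightarrow> dist (y u) p \<le> 2 * d) \<Longrightarrow> card G \<le> N"
proof -
  obtain K where K: "K > 0"
    "\<And>k u x y. u \<in> words I 1 k \<Longrightarrow> x \<in> Jw u \<Longrightarrow> y \<in> Jw u \<Longrightarrow> dist x y \<le> K * word_norm 1 u"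
    using cylinder_diameter by blast
  obtain \<kappa> where \<kappa>: "\<kappa> > 0"
    "\<And>k u. u \<in> words I 1 k \<Longrightarrow> \<exists>z\<in>Jw u. ball z (\<kappa> * word_norm 1 u) \<subseteq> interior (Jw u)"
    using cylinder_inner_ball by blast
  have "0 < \<kappa> / 4" using \<kappa> by simp
  from card_separated_bounded[OF this, of "K + 3"] obtain N where N:
    "\<And>(x :: 'a) d S. 0 < d \<Longrightarrow> finite S \<Longrightarrow> S \<subseteq> cball x ((K + 3) * d) \<Longrightarrow>
      (\<And>y z. y \<in> S \<Longrightarrow> z \<in> S \<Longrightarrow> y \<noteq> z \<Longrightarrow> \<kappa> / 4 * d < dist y z) \<Longrightarrow> card S \<le> N" by blast
  show ?thesis
  proof (rule that[of N])
    fix k d G and y :: "'i list \<Rightarrow> 'a" and p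
    assume d: "0 < d" and G: "finite G" "G \<subseteq> words I 1 k"
      and norms: "\<And>u. u \<in> G \<Longrightarrow> d / 2 < word_norm 1 u \<and> word_norm 1 u \<le> d"
      and y: "\<And>u. u \<in> G \<Longrightarrow> \<exists>x\<in>Jw u. dist x (y u) \<le> d"
      and p: "\<And>u. u \<in> G \<Longrightarrow> dist (y u) p \<le> 2 * d"
    have "\<forall>u\<in>G. \<exists>z\<in>Jw u. ball z (\<kappa> * word_norm 1 u) \<subseteq> interior (Jw u)" using \<kappa>(2) G by blast
    then obtain z where z: "\<And>u. u \<in> G \<Longrightarrow> z u \<in> Jw u"
      "\<And>u. u \<in> G \<Longrightarrow> ball (z u) (\<kappa> * word_norm 1 u) \<subseteq> interior (Jw u)" by metis
    have sep: "\<kappa> / 4 * d < dist (z u) (z v)" if uv: "u \<in> G" "v \<in> G" "u \<noteq> v" for u v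
    proof -
      have "0 < \<kappa> * word_norm 1 v" using norms[OF uv(2)] d \<kappa> by simp
      then have "z v \<in> interior (Jw v)" using z(2)[OF uv(2)] centre_in_ball by blast
      then have "z v \<notin> interior (Jw u)" using interiors_disjoint[of u k v] uv G by blast
      then have "\<kappa> * word_norm 1 u \<le> dist (z u) (z v)" using z(2)[OF uv(1)] by (meson mem_ball not_le subsetD)
      moreover have "\<kappa> * (d / 2) < \<kappa> * word_norm 1 u" using norms[OF uv(1)] \<kappa> by simp
      moreover have "\<kappa> / 4 * d \<le> \<kappa> * (d / 2)" using \<kappa> d by simp
      ultimately show ?thesis by linarith
    qed
    have "inj_on z G"
    proof (rule inj_onI, rule ccontr)
      fix u v assume "u \<in> G" "v \<in> G" "z u = z v" "u \<noteq> v"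
      then show False using sep[of u v] \<kappa> d by (simp add: mult_less_0_iff not_less[symmetric])
    qed
    then have "card G = card (z ` G)" by (rule card_image[symmetric])
    also have "\<dots> \<le> N"
    proof (rule N[OF d])
      show "finite (z ` G)" using G by simp
      show "z ` G \<subseteq> cball p ((K + 3) * d)"
      proof
        fix q assume "q \<in> z ` G"
        then obtain u where u: "u \<in> G" "q = z u" by blast
        obtain x where x: "x \<in> Jw u" "dist x (y u) \<le> d" using y[OF u(1)] by blast
        have "dist (z u) x \<le> K * word_norm 1 u" using K(2) z(1) x(1) u(1) G by blast
        also have "\<dots> \<le> K * d" using norms[OF u(1)] K(1) by simp
        finally have "dist p (z u) \<le> 2 * d + d + K * d"
          using p[OF u(1)] x(2) dist_triangle[of p "z u" x] dist_triangle[of p x "y u"]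
          by (simp add: dist_commute)
        then show "q \<in> cball p ((K + 3) * d)" using u by (simp add: algebra_simps)
      qed
      fix q q' assume "q \<in> z ` G" "q' \<in> z ` G" "q \<noteq> q'"
      then show "\<kappa> / 4 * d < dist q q'" using sep by blast
    qed
    finally show "card G \<le> N" .
  qed
qed

text \<open>Below the word \<open>w\<close>, the sums of the norms with an exponent \<open>s'\<close> between \<open>s\<close> and the critical exponent are
  unbounded. By the dyadic pigeonhole principle there is a scale \<open>d = 2 powr - n\<close> at which more than
  \<open>L' * d powr - s\<close> cylinders have norm about \<open>d\<close>. Points of \<open>A\<close> close to these cylinders, thinned out by
  a bounded factor, are centres of disjoint balls of radius \<open>d\<close>, and their contribution to the premeasure
  is at least \<open>L\<close>.\<close>

lemma packing_premeasure_infinite: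
  assumes "0 \<le> s" "ereal s < critical_exponent I J \<phi>" "w \<in> words I 1 m" "E \<inter> Jw w \<subseteq> closure A"
  shows "packing_premeasure s A = \<infinity>"
proof -
  obtain s' where s': "s < s'" "ereal s' < critical_exponent I J \<phi>"
    using ereal_dense2[OF assms(2)] by auto
  obtain N :: nat where N:
    "\<And>k d G (y :: 'i list \<Rightarrow> 'a) p. 0 < d \<Longrightarrow> finite G \<Longrightarrow> G \<subseteq> words I 1 k \<Longrightarrow>
       (\<And>u. u \<in> G \<Longrightarrow> d / 2 < word_norm 1 u \<and> word_norm 1 u \<le> d) \<Longrightarrow>
       (\<And>u. u \<in> G \<Longrightarrow> \<exists>x\<in>Jw u. dist x (y u) \<le> d) \<Longrightarrow>
       (\<And>u. u \<in> G \<Longrightarrow> dist (y u) p \<le> 2 * d) \<Longrightarrow> card G \<le> N"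
    using cylinder_overlap_bound by blast
  have large: "ennreal L \<le> packing_premeasure_at s \<delta> A" if \<delta>: "0 < \<delta>" and L: "0 \<le> L" for \<delta> L
  proof -
    obtain n0 :: nat where n0: "(1/2) ^ n0 < \<delta>" using real_arch_pow_inv[OF \<delta>, of "1/2"] by auto
    have "(\<lambda>k. C * c ^ k) \<longlonglongrightarrow> C * 0"
      by (intro tendsto_mult_left LIMSEQ_realpow_zero) (use c in auto)
    then have "\<forall>\<^sub>F k in sequentially. C * c ^ k < (1/2) ^ n0" by (rule order_tendstoD) simp
    then obtain k0 where k0: "\<And>k. k \<ge> k0 \<Longrightarrow> C * c ^ k < (1/2) ^ n0"
      unfolding eventually_sequentially by blast
    define L' where "L' = real N * L"
    have L': "0 \<le> L'" using L by (simp add: L'_def)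
    obtain k where k: "k \<ge> k0" "m \<le> k"
      "L' * (2 powr (s - s')) ^ n0 / (1 - 2 powr (s - s')) < (\<Sum>v\<in>words I (Suc m) k. word_norm 1 (w @ v) powr s')"
    proof -
      have "0 \<le> s'" using s'(1) assms(1) by simp
      from word_norm_sums_below_word_unbounded[OF this s'(2) assms(3), of k0] show ?thesis
        using that by blast
    qed
    \<comment> \<open>\<open>C * c ^ k\<close> bounds all norms at level \<open>k\<close>, so only scales \<open>n \<ge> n0\<close> below the mesh \<open>\<delta>\<close> occur.\<close>
    define G0 where "G0 = (\<lambda>v. w @ v) ` words I (Suc m) k"
    have G0: "finite G0" "G0 \<subseteq> words I 1 k"
      using finite_words_I[of "Suc m" k] words_append[OF k(2), of w _ I] assms(3) unfolding G0_def by auto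
    have "(\<Sum>v\<in>words I (Suc m) k. word_norm 1 (w @ v) powr s') = (\<Sum>u\<in>G0. word_norm 1 u powr s')"
      unfolding G0_def by (subst sum.reindex) (auto simp: inj_on_def)
    then have big: "\<not> (\<Sum>u\<in>G0. word_norm 1 u powr s') \<le> L' * (2 powr (s - s')) ^ n0 / (1 - 2 powr (s - s'))"
      using k(3) by simp
    have norms: "0 < word_norm 1 u \<and> word_norm 1 u \<le> (1/2) ^ n0" if "u \<in> G0" for u
    proof -
      have "u \<in> words I 1 k" using that G0 by blast
      then show ?thesis using word_norm_pos[of 1 u k] word_norm_le_power[of u k] k0[OF k(1)] by simp
    qed
    have "\<exists>n\<ge>n0. L' * 2 powr (real n * s) <
        real (card {u \<in> G0. (1/2) ^ Suc n < word_norm 1 u \<and> word_norm 1 u \<le> (1/2) ^ n})"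
    proof (rule ccontr)
      assume "\<not> ?thesis"
      then have "(\<Sum>u\<in>G0. word_norm 1 u powr s') \<le> L' * (2 powr (s - s')) ^ n0 / (1 - 2 powr (s - s'))"
        using G0 assms(1) s'(1) L' norms
        by (intro sum_powr_le_if_dyadic_counts_le) (auto simp: not_less)
      then show False using big by blast
    qed
    then obtain n where n: "n \<ge> n0" and many: "L' * 2 powr (real n * s) <
        real (card {u \<in> G0. (1/2) ^ Suc n < word_norm 1 u \<and> word_norm 1 u \<le> (1/2) ^ n})"
      by blast
    define d :: real where "d = (1/2) ^ n"
    define G where "G = {u \<in> G0. d / 2 < word_norm 1 u \<and> word_norm 1 u \<le> d}"
    have d: "0 < d" "d \<le> \<delta>"
      using n0 power_decreasing[OF n, of "1/2::real"] unfolding d_def by (simp_all, linarith)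
    have G: "finite G" "G \<subseteq> words I 1 k" using G0 by (auto simp: G_def)
    have many: "L' * 2 powr (real n * s) < real (card G)"
      using many by (simp add: G_def d_def)
    have "\<exists>y\<in>A. \<exists>x\<in>Jw u. dist x y \<le> d" if u: "u \<in> G" for u
    proof -
      have uk: "u \<in> words I 1 k" using u G by blast
      obtain x where x: "x \<in> E" "x \<in> Jw u" using attractor_meets_cylinder[OF uk] by blast
      have "take m u = w" using u assms(3) by (auto simp: G_def G0_def words_def)
      then have "x \<in> closure A" using Jw_subset_take[OF uk k(2)] x assms(4) by blast
      then obtain y where "y \<in> A" "dist y x < d" using d(1) unfolding closure_approachable by blast
      then show ?thesis using x by (metis dist_commute less_imp_le)
    qed
    then obtain y where y: "\<And>u. u \<in> G \<Longrightarrow> y u \<in> A" "\<And>u. u \<in> G \<Longrightarrow> \<exists>x\<in>Jw u. dist x (y u) \<le> d"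
      by metis
    obtain H where H: "H \<subseteq> G" "\<And>g h. g \<in> H \<Longrightarrow> h \<in> H \<Longrightarrow> g \<noteq> h \<Longrightarrow> 2 * d < dist (y g) (y h)"
      "\<And>g. g \<in> G \<Longrightarrow> \<exists>h\<in>H. dist (y g) (y h) \<le> 2 * d"
      using separated_net[OF G(1), of "2 * d" y] d(1) by auto
    have "card G \<le> card H * N"
    proof (rule card_le_mult_of_cover[where T = "\<lambda>h. {u \<in> G. dist (y u) (y h) \<le> 2 * d}"])
      show "finite H" using H(1) G(1) finite_subset by blast
      show "G \<subseteq> (\<Union>h\<in>H. {u \<in> G. dist (y u) (y h) \<le> 2 * d})" using H(3) by blast
      fix h assume "h \<in> H"
      have "card {u \<in> G. dist (y u) (y h) \<le> 2 * d} \<le> N"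
      proof (rule N[of d _ k y "y h"])
        show "finite {u \<in> G. dist (y u) (y h) \<le> 2 * d}" using G(1) by simp
        show "{u \<in> G. dist (y u) (y h) \<le> 2 * d} \<subseteq> words I 1 k" using G(2) by blast
        show "d / 2 < word_norm 1 u \<and> word_norm 1 u \<le> d"
          if "u \<in> {u \<in> G. dist (y u) (y h) \<le> 2 * d}" for u using that by (simp add: G_def)
      qed (use d y(2) in auto)
      then show "finite {u \<in> G. dist (y u) (y h) \<le> 2 * d} \<and> card {u \<in> G. dist (y u) (y h) \<le> 2 * d} \<le> N"
        using G(1) by simp
    qed
    then have cardG: "real (card G) \<le> real N * real (card H)"
      by (metis mult.commute of_nat_le_iff of_nat_mult)
    have dpow: "2 powr (real n * s) * d powr s = 1"
      by (simp add: d_def powr_powr power_one_over powr_divide flip: powr_realpow)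
    have "real N * L = L' * 2 powr (real n * s) * d powr s" using dpow by (simp add: L'_def mult.assoc)
    also have "\<dots> \<le> real (card G) * d powr s" using many by (intro mult_right_mono) auto
    also have "\<dots> \<le> real N * (real (card H) * d powr s)"
      using cardG mult_right_mono[OF cardG, of "d powr s"] by (simp add: mult.assoc)
    finally have NL: "real N * L \<le> real N * (real (card H) * d powr s)" .
    have "L \<le> real (card H) * d powr s"
    proof -
      have "0 < real (card G)" using many L' by (smt (verit) mult_nonneg_nonneg powr_ge_zero)
      then have "0 < real N" using cardG by (cases "N = 0") auto
      then show ?thesis using NL by simp
    qed
    then have "ennreal L \<le> ennreal (real (card H) * d powr s)" by (rule ennreal_leI)
    also have "\<dots> \<le> packing_premeasure_at s \<delta> A"
    proof (rule packing_premeasure_at_ge_card)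
      show "finite H" using H(1) G(1) by (rule finite_subset)
      show "y ` H \<subseteq> A" using y(1) H(1) by blast
    qed (use H(2) d assms(1) in auto)
    finally show ?thesis .
  qed
  have "packing_premeasure_at s \<delta> A = \<infinity>" if "0 < \<delta>" for \<delta>
  proof (rule ccontr)
    assume "packing_premeasure_at s \<delta> A \<noteq> \<infinity>"
    then obtain r where r: "0 \<le> r" "packing_premeasure_at s \<delta> A = ennreal r"
      by (metis ennreal_cases infinity_ennreal_def)
    then have "ennreal (r + 1) \<le> ennreal r" using large[OF that, of "r + 1"] by simp
    then show False using r(1) by simp
  qed
  then have "\<And>\<delta>. \<delta> \<in> {0<..} \<Longrightarrow> packing_premeasure_at s \<delta> A = \<infinity>" by simp
  then show ?thesis unfolding packing_premeasure_def by (intro INF_eq_const) simp_all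
qed

section \<open>The dimension estimates\<close>

text \<open>In a countable cover of the attractor, which is a complete metric space, the closure of some
  member contains a relatively open part by Baire's theorem, hence a whole cylinder piece of the
  attractor.\<close>

lemma packing_measure_positive:
  assumes "0 \<le> s" "ereal s < critical_exponent I J \<phi>"
  shows "packing_measure s E \<noteq> 0"
proof -
  have "packing_measure s E = \<infinity>"
    unfolding packing_measure_def
  proof (rule antisym[OF _ INF_greatest])
    fix A :: "nat \<Rightarrow> 'a set" assume "A \<in> {A. E \<subseteq> (\<Union>i. A i)}"
    then have A: "E \<subseteq> (\<Union>i. A i)" by simp
    have "\<exists>i x U. open U \<and> x \<in> E \<and> x \<in> U \<and> E \<inter> U \<subseteq> closure (A i)"
    proof (rule ccontr)
      assume neg: "\<not> ?thesis"
      have "E \<subseteq> closure (\<Inter>(range (\<lambda>i. E - closure (A i))))"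
      proof (rule Baire[OF attractor_closed])
        fix T assume "T \<in> range (\<lambda>i. E - closure (A i))"
        then obtain i where T: "T = E - closure (A i)" by blast
        have "E \<subseteq> closure T"
        proof
          fix x assume x: "x \<in> E"
          show "x \<in> closure T"
          proof (rule ccontr)
            assume "x \<notin> closure T"
            then have "open (- closure T)" "x \<in> - closure T" by auto
            moreover have "E \<inter> - closure T \<subseteq> closure (A i)" using closure_subset[of T] unfolding T by blast
            ultimately show False using neg x by blast
          qed
        qed
        moreover have "openin (top_of_set E) T"
          unfolding T by (simp add: Diff_eq openin_open_Int open_Compl)
        ultimately show "openin (top_of_set E) T \<and> E \<subseteq> closure T" by blast
      qed auto
      moreover have "(\<Inter>(range (\<lambda>i. E - closure (A i)))) = {}"
      proof (rule equals0I)
        fix x assume x: "x \<in> (\<Inter>(range (\<lambda>i. E - closure (A i))))"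
        then have "x \<in> E" by blast
        then obtain i where "x \<in> A i" using A by blast
        then have "x \<in> closure (A i)" using closure_subset by blast
        then show False using x by blast
      qed
      ultimately have "E \<subseteq> closure {}" by metis
      then show False using attractor_nonempty by simp
    qed
    then obtain i x U where U: "open U" "x \<in> E" "x \<in> U" "E \<inter> U \<subseteq> closure (A i)" by blast
    obtain m w where w: "w \<in> words I 1 m" "Jw w \<subseteq> U" using open_contains_cylinder[OF U(1-3)] by blast
    have "\<infinity> = packing_premeasure s (A i)"
    proof (rule packing_premeasure_infinite[OF assms w(1), symmetric])
      show "E \<inter> Jw w \<subseteq> closure (A i)" using U(4) w(2) by blast
    qed
    also have "\<dots> \<le> (\<Sum>i. packing_premeasure s (A i))"
      using sum_le_suminf[of "\<lambda>i. packing_premeasure s (A i)" "{i}"] by auto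
    finally show "\<infinity> \<le> (\<Sum>i. packing_premeasure s (A i))" .
  qed simp
  then show ?thesis by simp
qed

lemma critical_exponent_le_packing_dim: "critical_exponent I J \<phi> \<le> packing_dim E"
  unfolding packing_dim_def
proof (rule Inf_greatest, rule ccontr)
  fix z assume z: "z \<in> {ereal s |s. 0 \<le> s \<and> packing_measure s E = 0}" "\<not> critical_exponent I J \<phi> \<le> z"
  from z(1) obtain s where s: "z = ereal s" "0 \<le> s" "packing_measure s E = 0"
    by (elim CollectE exE conjE)
  have "ereal s < critical_exponent I J \<phi>" using z(2) unfolding s(1) not_le .
  then show False using packing_measure_positive[OF s(2)] s(3) by simp
qed

lemma packing_dim_attractor_le: "packing_dim E \<le> upper_box_dim E"
proof (rule packing_dim_le_upper_box_dim)
  show "bounded E"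
    using bounded_subset[OF compact_imp_bounded attractor_subset] J_props(1) by blast
qed (rule attractor_nonempty)

end

theorem proposition6p2:
  fixes I :: "nat \<Rightarrow> 'i set"
    and J :: "'a::euclidean_space set"
    and \<phi> :: "nat \<Rightarrow> 'i \<Rightarrow> 'a \<Rightarrow> 'a"
    and Jw :: "'i list \<Rightarrow> 'a set"
  assumes "nonautonomous_ifs I J \<phi> Jw"
    and "conformal_system I J \<phi>"
    and "open_set_condition I Jw"
    and "(\<lambda>k. (ln (max_level_norm I J \<phi> k) - ln (real (card (I k)))) / ln (max_word_norm I J \<phi> k))
           \<longlonglongrightarrow> 0"
  shows "upper_box_dim (attractor I Jw) \<ge> packing_dim (attractor I Jw) \<and>
         packing_dim (attractor I Jw) \<ge> critical_exponent I J \<phi>"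
proof -
  obtain V C where V: "open V" "connected V" "J \<subseteq> V"
    "\<forall>k\<ge>1. \<forall>i\<in>I k. conformal_diffeo_into V (\<phi> k i)"
    and C: "C \<ge> 1" "\<forall>l\<ge>1. \<forall>k\<ge>l. \<forall>u\<in>words I l k. \<forall>x\<in>V. \<forall>y\<in>V.
      deriv_scale (word_map \<phi> l u) x \<le> C * deriv_scale (word_map \<phi> l u) y"
    using assms(2) unfolding conformal_system_def by (elim exE conjE) (rule that)
  have "\<exists>c. 0 < c \<and> c < 1 \<and>
        (\<forall>k\<ge>1. \<forall>i\<in>I k. \<forall>x\<in>J. \<forall>y\<in>J. norm (\<phi> k i x - \<phi> k i y) \<le> c * norm (x - y))"
    using assms(1) unfolding nonautonomous_ifs_def by (elim conjE)
  then obtain c where c: "0 < c" "c < 1"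
    "\<forall>k\<ge>1. \<forall>i\<in>I k. \<forall>x\<in>J. \<forall>y\<in>J. norm (\<phi> k i x - \<phi> k i y) \<le> c * norm (x - y)"
    by blast
  interpret conformal_ifs I J \<phi> Jw V C c
  proof
    show "conformal_diffeo_into V (\<phi> k i)" if "1 \<le> k" "i \<in> I k" for k i
      using V(4) that by blast
    show "deriv_scale (word_map \<phi> l u) x \<le> C * deriv_scale (word_map \<phi> l u) y"
      if "1 \<le> l" "l \<le> k" "u \<in> words I l k" "x \<in> V" "y \<in> V" for l k u x y
      using C(2) that by blast
    show "norm (\<phi> k i x - \<phi> k i y) \<le> c * norm (x - y)"
      if "1 \<le> k" "i \<in> I k" "x \<in> J" "y \<in> J" for k i x y
      using c(3) that by blast
  qed (rule assms(1) assms(3) V(1-3) C(1) c(1,2))+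
  show ?thesis
    using packing_dim_attractor_le critical_exponent_le_packing_dim by blast
qed

end
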